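(* There exists a universal constant $C>0$ such that for every integer $d\ge2$ and every $(\mu,p)\in(0,1]^2$, for $G$ the hypercube graph on $\{0,1\}^d$ (two vertices adjacent if and only if they differ in exactly one coordinate), $$t_{\mathrm{mix}}^{\mathrm{full},(\mu,p),(\infty)}\le C\left(\frac{1}{\mu p}\,d\log d+\frac1\mu|\log(1-p)|\right).$$
   Context: Full process (random walk on dynamical percolation) on $G=(V,E)$ with parameters $(\mu,p)$: the continuous-time Markov chain $(X_t,\eta_t)_{t\ge0}$ on $V\times\{0,1\}^E$ (1 = open, 0 = closed) in which each edge independently refreshes at rate $\mu$, becoming open with probability $p$ and closed with probability $1-p$ independently of everything else; and at rate $1$ the walk $X$ chooses a uniformly random neighbour (in $G$) of its current location and jumps to it if and only if the connecting edge is currently open (otherwise it stays put). Its stationary distribution is $\pi_{\mathrm{full},p}=\pi\times\pi_p$, where $\pi(x)=\deg(x)/(2|E|)$ and $\pi_p$ is the product Bernoulli($p$) measure on $\{0,1\}^E$. $t_{\mathrm{mix}}^{\mathrm{full},(\mu,p),(\infty)}$ is the smallest $t\ge0$ such that for all states $z,w$ of the full process, $|\mathbb P_z((X_t,\eta_t)=w)/\pi_{\mathrm{full},p}(w)-1|\le1/4$. (When $p=1$ the bound is $+\infty$ and the claim is vacuous.) *)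

theory Defs
  imports "HOL-Probability.Probability"
begin

section \<open>Graphs\<close>

text \<open>A finite simple graph is given by its vertex set \<open>V\<close> and its set \<open>E\<close> of edges, each edge
  being a two-element subset of \<open>V\<close>.\<close>

definition neighbours :: "'v set \<Rightarrow> 'v set set \<Rightarrow> 'v \<Rightarrow> 'v set" where
  "neighbours V E x = {y \<in> V. {x, y} \<in> E}"

definition vertex_degree :: "'v set \<Rightarrow> 'v set set \<Rightarrow> 'v \<Rightarrow> nat" where
  "vertex_degree V E x = card (neighbours V E x)"

definition hypercube_verts :: "nat \<Rightarrow> (nat \<Rightarrow> nat) set" where
  "hypercube_verts d = {..<d} \<rightarrow>\<^sub>E {0, 1}"

definition hypercube_edges :: "nat \<Rightarrow> (nat \<Rightarrow> nat) set set" where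
  "hypercube_edges d = {{x, y} |x y. x \<in> hypercube_verts d \<and> y \<in> hypercube_verts d
      \<and> card {i \<in> {..<d}. x i \<noteq> y i} = 1}"


section \<open>Random walk on dynamical percolation\<close>

text \<open>A state \<open>(x, \<eta>)\<close> consists of the position of the walk and the environment, where \<open>\<eta> e\<close>
  means that the edge \<open>e\<close> is open. Environments are extensional functions (\<open>undefined\<close> off \<open>E\<close>),
  so the state space is finite.\<close>

type_synonym 'v full_state = "'v \<times> ('v set \<Rightarrow> bool)"

definition full_states :: "'v set \<Rightarrow> 'v set set \<Rightarrow> 'v full_state set" where
  "full_states V E = V \<times> (E \<rightarrow>\<^sub>E UNIV)"

text \<open>The infinitesimal generator. First sum: every edge is resampled at rate \<open>\<mu>\<close>, to open with
  probability \<open>p\<close> and to closed with probability \<open>1 - p\<close>. Second sum: at rate 1 the walk picks a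
  uniform neighbour in the underlying graph and moves there if the connecting edge is open.\<close>

definition full_generator ::
  "'v set \<Rightarrow> 'v set set \<Rightarrow> real \<Rightarrow> real \<Rightarrow> ('v full_state \<Rightarrow> real) \<Rightarrow> ('v full_state \<Rightarrow> real)" where
  "full_generator V E \<mu> p f = (\<lambda>(x, \<eta>).
      (\<Sum>e\<in>E. \<mu> * (p * (f (x, \<eta>(e := True)) - f (x, \<eta>))
                  + (1 - p) * (f (x, \<eta>(e := False)) - f (x, \<eta>))))
    + (\<Sum>y\<in>neighbours V E x. 1 / real (vertex_degree V E x)
                  * (if \<eta> {x, y} then f (y, \<eta>) - f (x, \<eta>) else 0)))"

text \<open>The transition semigroup \<open>exp (t L)\<close> of the finite-state chain with generator \<open>L\<close>.\<close>

definition full_semigroup ::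
  "'v set \<Rightarrow> 'v set set \<Rightarrow> real \<Rightarrow> real \<Rightarrow> real \<Rightarrow> ('v full_state \<Rightarrow> real) \<Rightarrow> ('v full_state \<Rightarrow> real)" where
  "full_semigroup V E \<mu> p t f z =
      (\<Sum>n. t ^ n / fact n * (full_generator V E \<mu> p ^^ n) f z)"

text \<open>The probability that the chain started in \<open>z\<close> is in \<open>w\<close> at time \<open>t\<close>.\<close>

definition full_prob ::
  "'v set \<Rightarrow> 'v set set \<Rightarrow> real \<Rightarrow> real \<Rightarrow> real \<Rightarrow> 'v full_state \<Rightarrow> 'v full_state \<Rightarrow> real" where
  "full_prob V E \<mu> p t z w = full_semigroup V E \<mu> p t (indicator {w}) z"

definition pi_full :: "'v set \<Rightarrow> 'v set set \<Rightarrow> real \<Rightarrow> 'v full_state \<Rightarrow> real" where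
  "pi_full V E p = (\<lambda>(x, \<eta>). real (vertex_degree V E x) / (2 * real (card E))
      * pmf (Pi_pmf E undefined (\<lambda>_. bernoulli_pmf p)) \<eta>)"

text \<open>The uniform mixing time, with threshold \<open>1/4\<close>. It is \<open>\<infinity>\<close> if no time qualifies; in particular
  for \<open>p = 1\<close>, where \<open>pi_full\<close> vanishes at some states and Isabelle's \<open>a / 0 = 0\<close> applies.\<close>

definition full_tmix_inf :: "'v set \<Rightarrow> 'v set set \<Rightarrow> real \<Rightarrow> real \<Rightarrow> ereal" where
  "full_tmix_inf V E \<mu> p = Inf (ereal ` {t. 0 \<le> t \<and>
      (\<forall>z\<in>full_states V E. \<forall>w\<in>full_states V E.
         \<bar>full_prob V E \<mu> p t z w / pi_full V E p w - 1\<bar> \<le> 1 / 4)})"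

text \<open>\<open>\<bar>log x\<bar>\<close> with the convention \<open>\<bar>log 0\<bar> = \<infinity>\<close> (whereas \<open>ln 0 = 0\<close> in Isabelle).\<close>

definition abs_log :: "real \<Rightarrow> ereal" where
  "abs_log x = (if x = 0 then \<infinity> else ereal \<bar>ln x\<bar>)"


section \<open>The semigroup series converges and solves Kolmogorov's equation\<close>

lemma finite_full_states:
  assumes "finite V" "finite E"
  shows "finite (full_states V E)"
  using assms by (auto simp: full_states_def intro!: finite_PiE)

lemma full_generator_bound:
  assumes fin: "finite V" "finite E" and z: "z \<in> full_states V E"
    and b: "\<And>w. w \<in> full_states V E \<Longrightarrow> \<bar>f w\<bar> \<le> B"
  shows "\<bar>full_generator V E \<mu> p f z\<bar> \<le> (\<bar>\<mu>\<bar> * (2 * \<bar>p\<bar> + 2 * \<bar>1 - p\<bar>) * card E + 2 * card V) * B"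
proof -
  obtain x \<eta> where zz: "z = (x, \<eta>)" and x: "x \<in> V" and e: "\<eta> \<in> E \<rightarrow>\<^sub>E UNIV"
    using z by (auto simp: full_states_def)
  have B0: "0 \<le> B" using b[OF z] by linarith
  have d: "\<bar>f w - f z\<bar> \<le> 2 * B" if "w \<in> full_states V E" for w
    using b[OF z] b[OF that] by linarith
  have upd: "(x, \<eta>(e' := c)) \<in> full_states V E" if "e' \<in> E" for e' c
    using e x that by (auto simp: full_states_def PiE_iff extensional_def)
  have 1: "\<bar>\<Sum>e\<in>E. \<mu> * (p * (f (x, \<eta>(e := True)) - f (x, \<eta>))
                  + (1 - p) * (f (x, \<eta>(e := False)) - f (x, \<eta>)))\<bar>
       \<le> (\<Sum>e\<in>E. \<bar>\<mu>\<bar> * (\<bar>p\<bar> * (2 * B) + \<bar>1 - p\<bar> * (2 * B)))"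
    apply (rule order_trans[OF sum_abs], rule sum_mono)
    unfolding abs_mult
    apply (rule mult_left_mono)
     apply (rule order_trans[OF abs_triangle_ineq])
     apply (unfold abs_mult)
     apply (intro add_mono mult_left_mono)
    using d upd by (auto simp: zz)
  have nb: "y \<in> V" if "y \<in> neighbours V E x" for y using that by (auto simp: neighbours_def)
  have "\<bar>\<Sum>y\<in>neighbours V E x. 1 / real (vertex_degree V E x)
                  * (if \<eta> {x, y} then f (y, \<eta>) - f (x, \<eta>) else 0)\<bar>
       \<le> (\<Sum>y\<in>neighbours V E x. 1 * (2 * B))"
    apply (rule order_trans[OF sum_abs], rule sum_mono)
    unfolding abs_mult
    apply (rule mult_mono)
       apply (simp add: divide_le_eq)
    using d e nb B0 by (auto simp: zz full_states_def)
  also have "\<dots> \<le> (\<Sum>y\<in>V. 1 * (2 * B))"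
    using fin B0 by (intro sum_mono2) (auto simp: neighbours_def)
  finally have 2: "\<bar>\<Sum>y\<in>neighbours V E x. 1 / real (vertex_degree V E x)
                  * (if \<eta> {x, y} then f (y, \<eta>) - f (x, \<eta>) else 0)\<bar> \<le> (\<Sum>y\<in>V. 1 * (2 * B))" .
  have 3: "(\<Sum>e\<in>E. \<bar>\<mu>\<bar> * (\<bar>p\<bar> * (2 * B) + \<bar>1 - p\<bar> * (2 * B))) + (\<Sum>y\<in>V. 1 * (2 * B))
      = (\<bar>\<mu>\<bar> * (2 * \<bar>p\<bar> + 2 * \<bar>1 - p\<bar>) * card E + 2 * card V) * B"
    by (simp add: algebra_simps)
  show ?thesis
    unfolding full_generator_def zz prod.case 3[symmetric]
    by (rule order_trans[OF abs_triangle_ineq add_mono[OF 1 2]])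
qed

lemma full_semigroup_summable:
  assumes fin: "finite V" "finite E" and z: "z \<in> full_states V E"
  shows "summable (\<lambda>n. (full_generator V E \<mu> p ^^ n) f z / fact n * t ^ n)"
proof -
  define K where "K = \<bar>\<mu>\<bar> * (2 * \<bar>p\<bar> + 2 * \<bar>1 - p\<bar>) * card E + 2 * card V"
  define B where "B = (\<Sum>w\<in>full_states V E. \<bar>f w\<bar>)"
  have bnd: "\<bar>(full_generator V E \<mu> p ^^ n) f w\<bar> \<le> K ^ n * B" if "w \<in> full_states V E" for n w
    using that
  proof (induction n arbitrary: w)
    case 0
    then show ?case unfolding B_def
      using member_le_sum[of w "full_states V E" "\<lambda>w. \<bar>f w\<bar>"] finite_full_states[OF fin] by auto
  next
    case (Suc n)
    from full_generator_bound[OF fin Suc.prems Suc.IH, where \<mu> = \<mu> and p = p]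
    show ?case by (simp add: K_def mult.assoc)
  qed
  have K0: "0 \<le> K" unfolding K_def by simp
  show ?thesis
  proof (rule summable_comparison_test)
    show "summable (\<lambda>n. B * ((K * \<bar>t\<bar>) ^ n / fact n))"
      using summable_exp[of "K * \<bar>t\<bar>"] by (intro summable_mult) (simp add: field_simps)
    show "\<exists>N. \<forall>n\<ge>N. norm ((full_generator V E \<mu> p ^^ n) f z / fact n * t ^ n)
        \<le> B * ((K * \<bar>t\<bar>) ^ n / fact n)"
    proof (intro exI allI impI)
      fix n
      have "norm ((full_generator V E \<mu> p ^^ n) f z / fact n * t ^ n)
        = \<bar>(full_generator V E \<mu> p ^^ n) f z\<bar> * (\<bar>t\<bar> ^ n / fact n)"
        by (simp add: abs_mult power_abs)
      also have "\<dots> \<le> K ^ n * B * (\<bar>t\<bar> ^ n / fact n)"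
        by (rule mult_right_mono[OF bnd[OF z]]) simp
      finally show "norm ((full_generator V E \<mu> p ^^ n) f z / fact n * t ^ n)
        \<le> B * ((K * \<bar>t\<bar>) ^ n / fact n)"
        by (simp add: power_mult_distrib mult_ac)
    qed
  qed
qed

lemma full_semigroup_0: "full_semigroup V E \<mu> p 0 f z = f z"
  using powser_zero[of "\<lambda>n. (full_generator V E \<mu> p ^^ n) f z / fact n"]
  by (simp add: full_semigroup_def mult.commute)

lemma full_semigroup_kolmogorov:
  assumes "finite V" "finite E" "z \<in> full_states V E"
  shows "((\<lambda>t. full_semigroup V E \<mu> p t f z) has_real_derivative
           full_semigroup V E \<mu> p t (full_generator V E \<mu> p f) z) (at t)"
proof -
  define c where "c = (\<lambda>n. (full_generator V E \<mu> p ^^ n) f z / fact n)"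
  have "((\<lambda>t. \<Sum>n. c n * t ^ n) has_real_derivative (\<Sum>n. diffs c n * t ^ n)) (at t)"
    by (rule termdiffs_strong_converges_everywhere)
       (use full_semigroup_summable[OF assms] in \<open>simp add: c_def\<close>)
  moreover have "diffs c n = (full_generator V E \<mu> p ^^ n) (full_generator V E \<mu> p f) z / fact n" for n
    by (simp add: diffs_def c_def funpow_swap1 del: of_nat_Suc)
  ultimately show ?thesis
    by (simp add: full_semigroup_def c_def mult.commute)
qed

end

theory Submission
  imports Defs
begin

text \<open>Let \<open>U t\<close> be the density of the chain at time \<open>t\<close> with respect to the stationary distribution.
  The environment marginal of \<open>U t\<close> is an explicit product over the edges, and it is at most
  \<open>M = exp (1 / 16)\<close> everywhere once \<open>t\<close> exceeds
  \<open>T = (ln (16 d 2\<^sup>d) - ln p - ln (1 - p)) / \<mu>\<close>.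

  A step across a closed edge can be simulated by opening the edge, crossing it and closing it
  again. So the Dirichlet form dominates \<open>\<mu> p / (6 d)\<close> times that of a walk ignoring
  the environment, and for a frozen environment the latter satisfies the
  logarithmic Sobolev inequality of the hypercube. Only the walk needs such an inequality, since
  boundedness of the marginal stands in for one in the environment directions. This is what
  keeps \<open>ln (1 - p)\<close> additive. In entropy form, with \<open>u t\<close> the mean of \<open>(U t)\<^sup>2\<close>, this yields
  \<open>u' \<le> - \<mu> p / (3 d) u ln (u / M\<^sup>2)\<close> after time \<open>T\<close>, where \<open>u T \<le> 2\<^sup>d M\<^sup>2\<close>. Hence
  \<open>ln u\<close> is of constant size after a further time of order \<open>d ln d / (\<mu> p)\<close>.
  By reversibility, doubling the time turns the bound on \<open>u\<close> into a uniform one.\<close>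

section \<open>Flips and edges of the hypercube\<close>

text \<open>Subtraction is truncated: \<open>1 - n\<close> differs from every natural
  \<open>n\<close>, which gives \<open>flip_neq\<close> for arbitrary \<open>x\<close>, but undoing
  a flip relies on the value being 0 or 1.\<close>

definition flip :: "nat \<Rightarrow> (nat \<Rightarrow> nat) \<Rightarrow> nat \<Rightarrow> nat" where
  "flip i x = x(i := 1 - x i)"

lemma finite_hypercube_verts [simp]: "finite (hypercube_verts d)"
  by (auto simp: hypercube_verts_def intro!: finite_PiE)

lemma card_hypercube_verts: "card (hypercube_verts d) = 2 ^ d"
  by (simp add: hypercube_verts_def card_PiE numeral_2_eq_2)

lemma hypercube_verts_le_1: "x \<in> hypercube_verts d \<Longrightarrow> i < d \<Longrightarrow> x i \<le> 1"
  by (force simp: hypercube_verts_def PiE_iff)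

lemma flip_in_verts: "x \<in> hypercube_verts d \<Longrightarrow> i < d \<Longrightarrow> flip i x \<in> hypercube_verts d"
  by (auto simp: hypercube_verts_def flip_def PiE_iff extensional_def)

lemma flip_flip: "x \<in> hypercube_verts d \<Longrightarrow> i < d \<Longrightarrow> flip i (flip i x) = x"
  using hypercube_verts_le_1[of x d i] by (auto simp: flip_def fun_eq_iff)

lemma flip_neq: "flip i x \<noteq> x"
proof
  assume "flip i x = x"
  then have "flip i x i = x i" by simp
  then show False by (simp add: flip_def) arith
qed

lemma flip_eq_iff: "flip i x = flip j x \<longleftrightarrow> i = j"
proof
  assume *: "flip i x = flip j x"
  show "i = j"
  proof (rule ccontr)
    assume "i \<noteq> j"
    then have "flip i x i = x i" using * by (simp add: flip_def)
    then show False by (simp add: flip_def) arith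
  qed
qed simp

lemma sum_flip:
  assumes "i < d"
  shows "(\<Sum>x\<in>hypercube_verts d. F (flip i x)) = (\<Sum>x\<in>hypercube_verts d. F x)"
  by (rule sum.reindex_bij_witness[where i = "flip i" and j = "flip i"])
     (use assms in \<open>auto simp: flip_flip flip_in_verts\<close>)

lemma differ_in_one_iff:
  assumes x: "x \<in> hypercube_verts d" and y: "y \<in> hypercube_verts d"
  shows "card {i \<in> {..<d}. x i \<noteq> y i} = 1 \<longleftrightarrow> (\<exists>i<d. y = flip i x)"
proof
  assume "card {i \<in> {..<d}. x i \<noteq> y i} = 1"
  then obtain i where i: "{i \<in> {..<d}. x i \<noteq> y i} = {i}" by (auto simp: card_1_singleton_iff)
  then have id: "i < d" "x i \<noteq> y i" by blast+
  have "y j = flip i x j" for j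
  proof (cases "j < d")
    case True
    show ?thesis
    proof (cases "j = i")
      case True
      then show ?thesis using id hypercube_verts_le_1[OF x \<open>i<d\<close>] hypercube_verts_le_1[OF y \<open>i<d\<close>]
        by (simp add: flip_def)
    next
      case False
      then have "x j = y j" using i \<open>j<d\<close> by blast
      then show ?thesis using False by (simp add: flip_def)
    qed
  next
    case False
    then show ?thesis using x y id(1) by (auto simp: flip_def hypercube_verts_def PiE_iff extensional_def)
  qed
  then show "\<exists>i<d. y = flip i x" using id(1) by blast
next
  assume "\<exists>i<d. y = flip i x"
  then obtain i where i: "i < d" "y = flip i x" by blast
  have "{j \<in> {..<d}. x j \<noteq> y j} = {i}"
  proof -
    have "x i \<noteq> 1 - x i" by arith
    then show ?thesis using i by (auto simp: flip_def)
  qed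
  then show "card {i \<in> {..<d}. x i \<noteq> y i} = 1" by simp
qed

lemma hypercube_edges_flip:
  "hypercube_edges d = {{x, flip i x} | x i. x \<in> hypercube_verts d \<and> i < d}"
  unfolding hypercube_edges_def using differ_in_one_iff flip_in_verts by blast

lemma flip_edge: "x \<in> hypercube_verts d \<Longrightarrow> i < d \<Longrightarrow> {x, flip i x} \<in> hypercube_edges d"
  unfolding hypercube_edges_flip by blast

lemma edge_at_vertex:
  assumes "x \<in> e" "e \<in> hypercube_edges d"
  shows "x \<in> hypercube_verts d \<and> (\<exists>i<d. e = {x, flip i x})"
proof -
  obtain y i where y: "y \<in> hypercube_verts d" "i < d" "e = {y, flip i y}"
    using assms(2) unfolding hypercube_edges_flip by blast
  show ?thesis
  proof (cases "x = y")
    case False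
    then have "x = flip i y" using assms y by auto
    then have "e = {x, flip i x}" using y by (simp add: flip_flip insert_commute)
    then show ?thesis using y flip_in_verts \<open>x = flip i y\<close> by auto
  qed (use y in blast)
qed

lemma finite_hypercube_edges [simp]: "finite (hypercube_edges d)"
proof (rule finite_subset)
  show "hypercube_edges d \<subseteq> Pow (hypercube_verts d)"
    using edge_at_vertex by blast
qed simp

lemma neighbours_hypercube:
  assumes "x \<in> hypercube_verts d"
  shows "neighbours (hypercube_verts d) (hypercube_edges d) x = (\<lambda>i. flip i x) ` {..<d}"
proof -
  have "\<exists>i<d. y = flip i x" if xy: "{x, y} \<in> hypercube_edges d" for y
  proof -
    obtain i where i: "i < d" "{x, y} = {x, flip i x}"
      using edge_at_vertex[of x "{x, y}" d] xy by blast
    then show ?thesis by (metis doubleton_eq_iff)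
  qed
  then show ?thesis using assms flip_in_verts flip_edge by (auto simp: neighbours_def image_iff)
qed

lemma vertex_degree_hypercube:
  assumes "x \<in> hypercube_verts d"
  shows "vertex_degree (hypercube_verts d) (hypercube_edges d) x = d"
  unfolding vertex_degree_def neighbours_hypercube[OF assms]
  by (simp add: card_image inj_on_def flip_eq_iff)

lemma inj_on_edges_at: "inj_on (\<lambda>i. {x, flip i x}) A"
  by (auto simp: inj_on_def doubleton_eq_iff flip_eq_iff flip_neq)

text \<open>Double counting of incidences between vertices and edges.\<close>

lemma card_hypercube_edges: "2 * card (hypercube_edges d) = d * 2 ^ d"
proof -
  have "card {e \<in> hypercube_edges d. x \<in> e} = d" if x: "x \<in> hypercube_verts d" for x
  proof -
    have "{e \<in> hypercube_edges d. x \<in> e} = (\<lambda>i. {x, flip i x}) ` {..<d}"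
      using x edge_at_vertex[of x _ d] flip_edge[of x d] unfolding image_def by blast
    then show ?thesis by (simp add: card_image inj_on_edges_at)
  qed
  moreover have "card {x \<in> hypercube_verts d. x \<in> e} = 2" if e: "e \<in> hypercube_edges d" for e
  proof -
    obtain x i where xi: "x \<in> hypercube_verts d" "i < d" "e = {x, flip i x}"
      using e unfolding hypercube_edges_flip by blast
    then have "{x \<in> hypercube_verts d. x \<in> e} = {x, flip i x}"
      using flip_in_verts by auto
    then show ?thesis by (simp add: flip_neq[symmetric])
  qed
  ultimately have "(\<Sum>x\<in>hypercube_verts d. d) = 2 * card (hypercube_edges d)"
    using sum_multicount_gen[of "hypercube_verts d" "hypercube_edges d" "(\<in>)" "\<lambda>_. 2"]
    by (simp add: mult.commute)
  then show ?thesis by (simp add: card_hypercube_verts mult.commute)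
qed

section \<open>Logarithmic Sobolev and Nash inequalities on the hypercube\<close>

lemma sum_hypercube_Suc:
  "(\<Sum>x\<in>hypercube_verts (Suc d). F x)
     = (\<Sum>x\<in>hypercube_verts d. F (x(d := 0)) + F (x(d := 1)))"
proof -
  have "(\<Sum>x\<in>hypercube_verts (Suc d). F x)
      = (\<Sum>(s, x)\<in>{0, 1} \<times> hypercube_verts d. F (x(d := s)))"
    unfolding hypercube_verts_def lessThan_Suc PiE_insert_eq
    using inj_combinator[of d "{..<d}" "\<lambda>_. {0, 1}"]
    by (subst sum.reindex) (auto simp: case_prod_unfold o_def simp flip: One_nat_def)
  also have "\<dots> = (\<Sum>s\<in>{0, 1}. \<Sum>x\<in>hypercube_verts d. F (x(d := s)))"
    by (rule sum.cartesian_product[symmetric])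
  finally show ?thesis by (simp add: sum.distrib)
qed

text \<open>The tangent bound \<open>ln r \<le> r - 1\<close> at \<open>r = y / x\<close>. It trades
  the logarithm of a varying \<open>x\<close> for that of a freely chosen constant \<open>y\<close>,
  at a cost linear in \<open>x\<close>.\<close>

lemma mult_ln_ratio_le:
  fixes x y :: real
  assumes "0 \<le> x" "0 < y"
  shows "x - y \<le> x * (ln x - ln y)"
proof (cases "x = 0")
  case False
  then have x: "x > 0" using assms by simp
  have "ln (y / x) \<le> y / x - 1" using x assms by (intro ln_le_minus_one) simp
  then have "x * ln (y / x) \<le> x * (y / x - 1)" using x by (intro mult_left_mono) auto
  then show ?thesis using x assms by (simp add: ln_div algebra_simps)
qed (use assms in simp)

text \<open>Entropy is at most variance over mean. With \<open>m\<close> the mean of the two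
  squares, the tangent bound leaves \<open>(a - b)\<^sup>2 * (a + b)\<^sup>2 / (2 * m)\<close>, and
  \<open>(a + b)\<^sup>2 \<le> 4 * m\<close>.\<close>

lemma two_point_log_Sobolev:
  fixes a b :: real
  assumes "0 \<le> a" "0 \<le> b"
  shows "a\<^sup>2 * ln (a\<^sup>2) + b\<^sup>2 * ln (b\<^sup>2) - (a\<^sup>2 + b\<^sup>2) * ln ((a\<^sup>2 + b\<^sup>2) / 2) \<le> 2 * (a - b)\<^sup>2"
proof (cases "a = 0 \<and> b = 0")
  case False
  define m where "m = (a\<^sup>2 + b\<^sup>2) / 2"
  have m: "m > 0" using False by (auto simp: m_def add_pos_nonneg add_nonneg_pos sum_power2_gt_zero_iff)
  have *: "x * ln x \<le> x * ln m + x * (x / m - 1)" if "0 \<le> x" for x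
  proof (cases "x = 0")
    case False
    then have "ln (x / m) \<le> x / m - 1" using m that by (intro ln_le_minus_one) simp
    then have "x * ln (x / m) \<le> x * (x / m - 1)" using that by (intro mult_left_mono) auto
    then show ?thesis using False that m by (simp add: ln_div algebra_simps)
  qed simp
  have "a\<^sup>2 * (a\<^sup>2 / m - 1) + b\<^sup>2 * (b\<^sup>2 / m - 1) = (a\<^sup>2 - b\<^sup>2)\<^sup>2 / (2 * m)"
  proof -
    have b: "b\<^sup>2 = 2 * m - a\<^sup>2" by (simp add: m_def add_divide_distrib)
    show ?thesis unfolding b using m by (simp add: field_simps power2_eq_square)
  qed
  also have "(a\<^sup>2 - b\<^sup>2)\<^sup>2 = (a - b)\<^sup>2 * (a + b)\<^sup>2"
    by (simp add: power2_eq_square algebra_simps)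
  also have "(a - b)\<^sup>2 * (a + b)\<^sup>2 / (2 * m) \<le> 2 * (a - b)\<^sup>2"
  proof -
    have "0 \<le> (a - b)\<^sup>2" by simp
    then have "(a + b)\<^sup>2 \<le> 4 * m" by (simp add: m_def power2_eq_square algebra_simps)
    then have "(a - b)\<^sup>2 * (a + b)\<^sup>2 \<le> (a - b)\<^sup>2 * (4 * m)" by (intro mult_left_mono) auto
    then show ?thesis using m by (simp add: divide_le_eq algebra_simps)
  qed
  finally show ?thesis
    using *[of "a\<^sup>2"] *[of "b\<^sup>2"] unfolding m_def[symmetric] by (simp add: m_def algebra_simps)
qed auto

text \<open>The reverse triangle inequality of the Euclidean norm; it lets the two-point inequality
  act on the norms of the two halves of a cube.\<close>

lemma sqrt_sum_squares_diff:
  fixes f g :: "'a \<Rightarrow> real"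
  shows "(sqrt (\<Sum>x\<in>A. (f x)\<^sup>2) - sqrt (\<Sum>x\<in>A. (g x)\<^sup>2))\<^sup>2 \<le> (\<Sum>x\<in>A. (f x - g x)\<^sup>2)"
proof -
  have *: "L2_set u A \<le> L2_set v A + L2_set (\<lambda>x. u x - v x) A" for u v :: "'a \<Rightarrow> real"
    using L2_set_triangle_ineq[of v "\<lambda>x. u x - v x" A] by simp
  have "L2_set (\<lambda>x. g x - f x) A = L2_set (\<lambda>x. f x - g x) A"
    by (simp add: L2_set_def power2_commute)
  then have "\<bar>L2_set f A - L2_set g A\<bar> \<le> L2_set (\<lambda>x. f x - g x) A"
    using *[of f g] *[of g f] by linarith
  then have "\<bar>L2_set f A - L2_set g A\<bar>\<^sup>2 \<le> (L2_set (\<lambda>x. f x - g x) A)\<^sup>2"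
    by (intro power_mono) auto
  then show ?thesis by (simp add: L2_set_def sum_nonneg)
qed

text \<open>Tensorisation: the induction hypothesis handles the two facets \<open>g 0\<close> and
  \<open>g 1\<close>, and the two-point inequality for their Euclidean norms handles the last
  coordinate. The term with \<open>d * ln 2\<close> appears because sums stand in for
  averages.\<close>

lemma hypercube_log_Sobolev:
  fixes f :: "(nat \<Rightarrow> nat) \<Rightarrow> real"
  defines "A \<equiv> (\<lambda>d f. \<Sum>x\<in>hypercube_verts d. (f x)\<^sup>2)"
  shows "(\<Sum>x\<in>hypercube_verts d. (f x)\<^sup>2 * ln ((f x)\<^sup>2)) - A d f * ln (A d f) + A d f * (d * ln 2)
    \<le> (\<Sum>i<d. \<Sum>x\<in>hypercube_verts d. (f (flip i x) - f x)\<^sup>2)"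
proof (induction d arbitrary: f)
  case 0
  show ?case by (simp add: A_def hypercube_verts_def)
next
  case (Suc d)
  let ?V = "hypercube_verts d"
  define g where "g = (\<lambda>s x. f (x(d := s)))"
  define W where "W = (\<lambda>s. \<Sum>i<d. \<Sum>x\<in>?V. (g s (flip i x) - g s x)\<^sup>2)"
  define D where "D = (\<Sum>x\<in>?V. (g 0 x - g 1 x)\<^sup>2)"
  have A: "A (Suc d) f = A d (g 0) + A d (g 1)"
    by (simp add: A_def sum_hypercube_Suc g_def sum.distrib)
  have A0: "0 \<le> A d u" for u by (simp add: A_def sum_nonneg)
  have flip_upd: "flip i (x(d := s)) = (flip i x)(d := s)" if "i < d" for i s x
    using that by (auto simp: flip_def fun_eq_iff)
  have flip_last: "flip d (x(d := s)) = x(d := 1 - s)" for s x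
    by (auto simp: flip_def)
  have L: "(\<Sum>x\<in>hypercube_verts (Suc d). (f x)\<^sup>2 * ln ((f x)\<^sup>2))
      = (\<Sum>x\<in>?V. (g 0 x)\<^sup>2 * ln ((g 0 x)\<^sup>2)) + (\<Sum>x\<in>?V. (g 1 x)\<^sup>2 * ln ((g 1 x)\<^sup>2))"
    by (simp add: sum_hypercube_Suc g_def sum.distrib)
  have "(\<Sum>i<d. \<Sum>x\<in>hypercube_verts (Suc d). (f (flip i x) - f x)\<^sup>2) = W 0 + W 1"
    unfolding W_def by (simp add: sum_hypercube_Suc g_def flip_upd sum.distrib)
  \<comment> \<open>Each edge in the new direction is met from both ends; the resulting factor 2 is
    exactly the constant of the two-point inequality.\<close>
  moreover have "(\<Sum>x\<in>hypercube_verts (Suc d). (f (flip d x) - f x)\<^sup>2) = 2 * D"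
    unfolding D_def by (simp add: sum_hypercube_Suc g_def flip_last sum_distrib_left power2_commute)
  ultimately have R: "(\<Sum>i<Suc d. \<Sum>x\<in>hypercube_verts (Suc d). (f (flip i x) - f x)\<^sup>2) = W 0 + W 1 + 2 * D"
    by simp
  have "(sqrt (A d (g 0)) - sqrt (A d (g 1)))\<^sup>2 \<le> D"
    unfolding A_def D_def by (rule sqrt_sum_squares_diff)
  then have two: "A d (g 0) * ln (A d (g 0)) + A d (g 1) * ln (A d (g 1))
      - A (Suc d) f * ln (A (Suc d) f / 2) \<le> 2 * D"
    using two_point_log_Sobolev[of "sqrt (A d (g 0))" "sqrt (A d (g 1))"] A0
    by (simp add: A)
  have "A (Suc d) f * ln (A (Suc d) f / 2) = A (Suc d) f * ln (A (Suc d) f) - A (Suc d) f * ln 2"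
    using A0[of "g 0"] A0[of "g 1"] by (cases "A (Suc d) f = 0") (auto simp: A ln_div algebra_simps)
  then show ?case
    using two Suc.IH[of "g 0"] Suc.IH[of "g 1"] unfolding R L W_def[symmetric]
    by (simp add: A algebra_simps W_def)
qed

text \<open>A bound on the sum of \<open>f\<close> forces a large entropy of its square once
  \<open>A\<close> is large, and the logarithmic Sobolev inequality passes this on to the
  energy.\<close>

lemma hypercube_Nash:
  fixes f :: "(nat \<Rightarrow> nat) \<Rightarrow> real"
  assumes nonneg: "\<And>x. x \<in> hypercube_verts d \<Longrightarrow> 0 \<le> f x"
    and A: "A = (\<Sum>x\<in>hypercube_verts d. (f x)\<^sup>2)"
    and B: "(\<Sum>x\<in>hypercube_verts d. f x) \<le> 2 ^ d * M" and M: "0 < M"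
  shows "A * (ln (A / 2 ^ d) - 2 * ln M)
    \<le> (\<Sum>i<d. \<Sum>x\<in>hypercube_verts d. (f (flip i x) - f x)\<^sup>2)"
proof (cases "A = 0")
  case True
  then show ?thesis by (simp add: sum_nonneg)
next
  case False
  let ?V = "hypercube_verts d"
  have A0: "A > 0" using False A by (metis less_eq_real_def sum_nonneg zero_le_power2)
  define N where "N = 2 ^ d * M"
  have N: "N > 0" using M by (simp add: N_def)
  have *: "(f x)\<^sup>2 * (2 * ln A - 2 * ln N) - 2 * (A / N * f x - (f x)\<^sup>2) \<le> (f x)\<^sup>2 * ln ((f x)\<^sup>2)"
    if x: "x \<in> ?V" for x
  proof (cases "f x = 0")
    case False
    then have f: "f x > 0" using nonneg[OF x] by simp
    \<comment> \<open>With tangent point \<open>A / N\<close> the linear errors add up to a multiple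
      of \<open>A / N * (\<Sum>x\<in>?V. f x) - A\<close>, which is at most 0 because
      \<open>N\<close> bounds the sum of \<open>f\<close>.\<close>
    have "f x - A / N \<le> f x * (ln (f x) - ln (A / N))"
      by (rule mult_ln_ratio_le) (use f A0 N in auto)
    from mult_left_mono[OF this, of "2 * f x"] f
    show ?thesis using A0 N by (simp add: ln_div ln_realpow power2_eq_square ln_mult algebra_simps)
  qed simp
  have "(\<Sum>x\<in>?V. (f x)\<^sup>2 * (2 * ln A - 2 * ln N) - 2 * (A / N * f x - (f x)\<^sup>2))
      \<le> (\<Sum>x\<in>?V. (f x)\<^sup>2 * ln ((f x)\<^sup>2))"
    by (rule sum_mono) (rule *)
  also have "(\<Sum>x\<in>?V. (f x)\<^sup>2 * (2 * ln A - 2 * ln N) - 2 * (A / N * f x - (f x)\<^sup>2))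
      = A * (2 * ln A - 2 * ln N) - 2 * (A / N * (\<Sum>x\<in>?V. f x) - A)"
    unfolding A by (simp add: sum_subtractf sum_distrib_left sum_distrib_right)
  finally have 1: "A * (2 * ln A - 2 * ln N) - 2 * (A / N * (\<Sum>x\<in>?V. f x) - A)
      \<le> (\<Sum>x\<in>?V. (f x)\<^sup>2 * ln ((f x)\<^sup>2))" .
  have "A / N * (\<Sum>x\<in>?V. f x) \<le> A / N * N"
    by (rule mult_left_mono) (use B A0 N in \<open>auto simp: N_def\<close>)
  then have 2: "A / N * (\<Sum>x\<in>?V. f x) \<le> A" using N by simp
  have 3: "ln N = d * ln 2 + ln M" "ln (A / 2 ^ d) = ln A - d * ln 2"
    using M A0 by (auto simp: N_def ln_mult ln_div ln_realpow)
  show ?thesis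
    using 1 2 hypercube_log_Sobolev[of f d] unfolding A[symmetric] 3 right_diff_distrib distrib_left
    by linarith
qed

section \<open>The Dirichlet form\<close>

lemma sum_PiE_bool_split:
  assumes "finite E" "e \<in> E"
  shows "(\<Sum>\<eta>\<in>E \<rightarrow>\<^sub>E (UNIV :: bool set). G \<eta>)
    = (\<Sum>\<eta>\<in>(E - {e}) \<rightarrow>\<^sub>E UNIV. G (\<eta>(e := True)) + G (\<eta>(e := False)))"
proof -
  have E: "E = insert e (E - {e})" using assms by auto
  have inj: "inj_on (\<lambda>(y, g). g(e := y)) ((UNIV :: bool set) \<times> ((E - {e}) \<rightarrow>\<^sub>E UNIV))"
    using inj_combinator[of e "E - {e}" "\<lambda>_. UNIV"] by simp
  have "(\<Sum>\<eta>\<in>E \<rightarrow>\<^sub>E (UNIV :: bool set). G \<eta>)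
      = (\<Sum>(c, \<eta>)\<in>UNIV \<times> ((E - {e}) \<rightarrow>\<^sub>E UNIV). G (\<eta>(e := c)))"
    by (subst E, subst PiE_insert_eq, subst sum.reindex[OF inj]) (auto simp: case_prod_unfold o_def)
  also have "\<dots> = (\<Sum>c\<in>UNIV. \<Sum>\<eta>\<in>(E - {e}) \<rightarrow>\<^sub>E UNIV. G (\<eta>(e := c)))"
    by (rule sum.cartesian_product[symmetric])
  finally show ?thesis by (simp add: UNIV_bool sum.distrib add.commute)
qed

text \<open>For \<open>p = 1\<close> the claimed bound is infinite; \<open>p < 1\<close> makes every
  environment have positive weight.\<close>

locale percolation_cube =
  fixes d :: nat and \<mu> p :: real
  assumes d: "0 < d" and \<mu>: "0 < \<mu>" "\<mu> \<le> 1" and p: "0 < p" "p < 1"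
begin

abbreviation "V \<equiv> hypercube_verts d"
abbreviation "E \<equiv> hypercube_edges d"
abbreviation "Env \<equiv> E \<rightarrow>\<^sub>E (UNIV :: bool set)"
abbreviation "L \<equiv> full_generator V E \<mu> p"

definition wt :: "((nat \<Rightarrow> nat) set \<Rightarrow> bool) \<Rightarrow> real" where
  "wt \<eta> = (\<Prod>e\<in>E. if \<eta> e then p else 1 - p)"

text \<open>Expectation under the stationary distribution, by \<open>pi_full_cube\<close>.\<close>

definition av :: "((nat \<Rightarrow> nat) full_state \<Rightarrow> real) \<Rightarrow> real" where
  "av f = (\<Sum>x\<in>V. \<Sum>\<eta>\<in>Env. wt \<eta> * f (x, \<eta>)) / 2 ^ d"

definition edge_diff :: "(nat \<Rightarrow> nat) set \<Rightarrow> ((nat \<Rightarrow> nat) full_state \<Rightarrow> real)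
    \<Rightarrow> (nat \<Rightarrow> nat) full_state \<Rightarrow> real" where
  "edge_diff e f = (\<lambda>(x, \<eta>). f (x, \<eta>(e := True)) - f (x, \<eta>(e := False)))"

definition dir_diff :: "nat \<Rightarrow> ((nat \<Rightarrow> nat) full_state \<Rightarrow> real)
    \<Rightarrow> (nat \<Rightarrow> nat) full_state \<Rightarrow> real" where
  "dir_diff i f = (\<lambda>(x, \<eta>). f (flip i x, \<eta>) - f (x, \<eta>))"

definition is_open :: "nat \<Rightarrow> (nat \<Rightarrow> nat) full_state \<Rightarrow> real" where
  "is_open i = (\<lambda>(x, \<eta>). if \<eta> {x, flip i x} then 1 else 0)"

text \<open>The energy form of the reversible generator, see \<open>av_generator\<close>. The factor
  \<open>p * (1 - p)\<close> is the variance of one edge; in \<open>2 * d\<close> the 2 comes from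
  symmetrising over both ends of an edge and \<open>d\<close> is the degree.\<close>

definition dirichlet :: "((nat \<Rightarrow> nat) full_state \<Rightarrow> real) \<Rightarrow> ((nat \<Rightarrow> nat) full_state \<Rightarrow> real) \<Rightarrow> real" where
  "dirichlet f g = \<mu> * (p * (1 - p)) * (\<Sum>e\<in>E. av (\<lambda>z. edge_diff e f z * edge_diff e g z))
     + (\<Sum>i<d. av (\<lambda>z. is_open i z * (dir_diff i f z * dir_diff i g z))) / (2 * d)"

lemma finite_Env [simp]: "finite Env"
  by (intro finite_PiE) auto

lemma states_iff: "(x, \<eta>) \<in> full_states V E \<longleftrightarrow> x \<in> V \<and> \<eta> \<in> Env"
  by (simp add: full_states_def)

lemma upd_Env: "\<eta> \<in> Env \<Longrightarrow> e \<in> E \<Longrightarrow> \<eta>(e := c) \<in> Env"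
  by (auto simp: PiE_iff extensional_def)

lemma wt_pos: "0 < wt \<eta>"
  unfolding wt_def by (rule prod_pos) (use p in auto)

lemma generator_cube:
  assumes "x \<in> V"
  shows "L f (x, \<eta>) = (\<Sum>e\<in>E. \<mu> * (p * (f (x, \<eta>(e := True)) - f (x, \<eta>))
                  + (1 - p) * (f (x, \<eta>(e := False)) - f (x, \<eta>))))
    + (\<Sum>i<d. is_open i (x, \<eta>) * dir_diff i f (x, \<eta>)) / d"
  using assms
  by (simp add: full_generator_def neighbours_hypercube vertex_degree_hypercube
      sum.reindex inj_on_def flip_eq_iff is_open_def dir_diff_def sum_divide_distrib)
     (rule sum.cong, auto)

text \<open>Refreshing one edge preserves the product measure: over the environments off
  \<open>e\<close> the weight factorises into the part at \<open>e\<close> and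
  \<open>w'\<close>.\<close>

lemma sum_wt_resample:
  assumes "e \<in> E"
  shows "(\<Sum>\<eta>\<in>Env. wt \<eta> * F \<eta>)
    = (\<Sum>\<eta>\<in>Env. wt \<eta> * (p * F (\<eta>(e := True)) + (1 - p) * F (\<eta>(e := False))))"
proof -
  define w' where "w' = (\<lambda>\<eta>. \<Prod>e'\<in>E - {e}. if \<eta> e' then p else 1 - p)"
  have w: "wt (\<eta>(e := c)) = (if c then p else 1 - p) * w' \<eta>" for \<eta> c
    unfolding wt_def w'_def using assms
    by (subst prod.remove[of _ e]) (auto intro!: prod.cong)
  show ?thesis
    unfolding sum_PiE_bool_split[OF finite_hypercube_edges assms, of "\<lambda>\<eta>. wt \<eta> * F \<eta>"]
      sum_PiE_bool_split[OF finite_hypercube_edges assms, of "\<lambda>\<eta>. wt \<eta> * (p * F (\<eta>(e := True)) + (1 - p) * F (\<eta>(e := False)))"]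
    by (rule sum.cong) (simp_all add: w algebra_simps)
qed

lemma av_cong: "(\<And>x \<eta>. x \<in> V \<Longrightarrow> \<eta> \<in> Env \<Longrightarrow> f (x, \<eta>) = g (x, \<eta>)) \<Longrightarrow> av f = av g"
  unfolding av_def by (intro arg_cong2[where f = "(/)"] sum.cong refl) simp

lemma av_mono: "(\<And>x \<eta>. x \<in> V \<Longrightarrow> \<eta> \<in> Env \<Longrightarrow> f (x, \<eta>) \<le> g (x, \<eta>)) \<Longrightarrow> av f \<le> av g"
  unfolding av_def by (intro divide_right_mono sum_mono mult_left_mono less_imp_le[OF wt_pos]) auto

lemma av_add: "av (\<lambda>z. f z + g z) = av f + av g"
  by (simp add: av_def sum.distrib distrib_left add_divide_distrib)

lemma av_cmult: "av (\<lambda>z. c * f z) = c * av f"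
  by (simp add: av_def sum_distrib_left mult.left_commute)

lemma av_diff: "av (\<lambda>z. f z - g z) = av f - av g"
  by (simp add: av_def sum_subtractf right_diff_distrib diff_divide_distrib)

lemma av_sum: "av (\<lambda>z. \<Sum>i\<in>I. f i z) = (\<Sum>i\<in>I. av (f i))"
proof (cases "finite I")
  case True
  then show ?thesis
    by (induction I rule: finite_induct) (simp_all add: av_add, simp add: av_def)
qed (simp add: av_def)

lemma av_nonneg: "(\<And>x \<eta>. x \<in> V \<Longrightarrow> \<eta> \<in> Env \<Longrightarrow> 0 \<le> f (x, \<eta>)) \<Longrightarrow> 0 \<le> av f"
  using av_mono[of "\<lambda>_. 0" f] by (simp add: av_def)

lemma av_flip:
  assumes "i < d"
  shows "av (\<lambda>(x, \<eta>). f (flip i x, \<eta>)) = av f"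
  unfolding av_def using sum_flip[OF assms, of "\<lambda>x. \<Sum>\<eta>\<in>Env. wt \<eta> * f (x, \<eta>)"] by simp

lemma av_resample:
  assumes "e \<in> E"
  shows "av f = av (\<lambda>(x, \<eta>). p * f (x, \<eta>(e := True)) + (1 - p) * f (x, \<eta>(e := False)))"
  unfolding av_def
  by (rule arg_cong2[where f = "(/)"], rule sum.cong, rule refl, simp only: prod.case,
      rule sum_wt_resample[OF assms]) simp

text \<open>The refreshed edge may depend on the position because the identity is applied for each
  \<open>x\<close> separately.\<close>

lemma av_resample_edge:
  assumes "i < d"
  shows "av f = av (\<lambda>(x, \<eta>). p * f (x, \<eta>({x, flip i x} := True)) + (1 - p) * f (x, \<eta>({x, flip i x} := False)))"
  unfolding av_def
  by (rule arg_cong2[where f = "(/)"], rule sum.cong, rule refl, simp only: prod.case,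
      rule sum_wt_resample, rule flip_edge) (use assms in auto)

lemma sum_wt: "(\<Sum>\<eta>\<in>Env. wt \<eta>) = 1"
proof -
  have "(\<Sum>\<eta>\<in>Env. wt \<eta>) = (\<Prod>e\<in>E. \<Sum>c\<in>UNIV. if c then p else 1 - p)"
    unfolding wt_def
    using prod_sum_PiE[of E "\<lambda>_. UNIV" "\<lambda>_ c. if c then p else 1 - p"] by simp
  then show ?thesis by (simp add: UNIV_bool)
qed

lemma av_const: "av (\<lambda>_. c) = c"
  by (simp add: av_def sum_distrib_right[symmetric] sum_wt card_hypercube_verts)

text \<open>Integration by parts. Its symmetry in \<open>f\<close> and \<open>g\<close> is the
  reversibility of the chain.\<close>

theorem av_generator: "av (\<lambda>z. g z * L f z) = - dirichlet f g"
proof -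
  define X where "X = (\<lambda>e (x, \<eta>). g (x, \<eta>) * (p * (f (x, \<eta>(e := True)) - f (x, \<eta>))
                  + (1 - p) * (f (x, \<eta>(e := False)) - f (x, \<eta>))))"
  define Y where "Y = (\<lambda>i z. g z * (is_open i z * dir_diff i f z))"
  have "av (\<lambda>z. g z * L f z) = av (\<lambda>z. \<mu> * (\<Sum>e\<in>E. X e z) + (1 / d) * (\<Sum>i<d. Y i z))"
    by (rule av_cong)
       (simp add: generator_cube X_def Y_def sum_distrib_left distrib_left sum_divide_distrib mult_ac)
  also have "\<dots> = \<mu> * (\<Sum>e\<in>E. av (X e)) + (1 / d) * (\<Sum>i<d. av (Y i))"
    by (simp only: av_add av_cmult av_sum)
  also have "(\<Sum>e\<in>E. av (X e)) = (\<Sum>e\<in>E. - (p * (1 - p)) * av (\<lambda>z. edge_diff e f z * edge_diff e g z))"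
  proof (rule sum.cong[OF refl])
    fix e assume e: "e \<in> E"
    \<comment> \<open>Forcing \<open>e\<close> open and forcing it closed leaves one term each, with
      the common weight \<open>p * (1 - p)\<close>.\<close>
    show "av (X e) = - (p * (1 - p)) * av (\<lambda>z. edge_diff e f z * edge_diff e g z)"
      unfolding av_cmult[symmetric] av_resample[OF e, of "X e"]
      by (rule av_cong) (simp add: X_def edge_diff_def algebra_simps)
  qed
  also have "(\<Sum>i<d. av (Y i)) = (\<Sum>i<d. - (1 / 2) * av (\<lambda>z. is_open i z * (dir_diff i f z * dir_diff i g z)))"
  proof (rule sum.cong[OF refl])
    fix i assume "i \<in> {..<d}"
    then have i: "i < d" by simp
    \<comment> \<open>The flip preserves \<open>av\<close> and the state of the connecting edge, so
      averaging over both ends symmetrises the term.\<close>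
    have "2 * av (Y i) = av (\<lambda>z. Y i z + (case z of (x, \<eta>) \<Rightarrow> Y i (flip i x, \<eta>)))"
      unfolding av_add av_flip[OF i] by simp
    also have "\<dots> = av (\<lambda>z. (-1) * (is_open i z * (dir_diff i f z * dir_diff i g z)))"
      by (rule av_cong)
         (auto simp: Y_def is_open_def dir_diff_def flip_flip i insert_commute algebra_simps)
    finally show "av (Y i) = - (1 / 2) * av (\<lambda>z. is_open i z * (dir_diff i f z * dir_diff i g z))"
      unfolding av_cmult by simp
  qed
  finally show ?thesis
    unfolding dirichlet_def sum_distrib_left[symmetric] by (simp add: field_simps)
qed

lemma dirichlet_sym: "dirichlet f g = dirichlet g f"
  by (simp add: dirichlet_def mult.commute mult.left_commute)

text \<open>Comparison along paths of length three: a move across a closed edge is written as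
  opening it, crossing and closing it again. Crossings are paid by the walk part of the form,
  openings and closings by the refresh part.\<close>

theorem dirichlet_comparison:
  "\<mu> * p / (6 * d) * (\<Sum>i<d. av (\<lambda>z. (dir_diff i f z)\<^sup>2)) \<le> dirichlet f f"
proof -
  define S where "S = (\<Sum>e\<in>E. av (\<lambda>z. (edge_diff e f z)\<^sup>2))"
  define O' where "O' = (\<Sum>i<d. av (\<lambda>z. is_open i z * (dir_diff i f z)\<^sup>2))"
  define N where "N = (\<lambda>i (x, \<eta>). (edge_diff {x, flip i x} f (x, \<eta>))\<^sup>2)"
  \<comment> \<open>At each position the \<open>d\<close> incident edges are distinct, so their
    refresh energies are part of the total over \<open>E\<close>.\<close>
  have N_sum: "(\<Sum>i<d. av (N i)) \<le> S"
  proof -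
    have "(\<Sum>i<d. N i (x, \<eta>)) \<le> (\<Sum>e\<in>E. (edge_diff e f (x, \<eta>))\<^sup>2)" if x: "x \<in> V" for x \<eta>
    proof -
      have "(\<Sum>i<d. N i (x, \<eta>)) = (\<Sum>e\<in>(\<lambda>i. {x, flip i x}) ` {..<d}. (edge_diff e f (x, \<eta>))\<^sup>2)"
        by (subst sum.reindex[OF inj_on_edges_at]) (simp add: N_def)
      also have "\<dots> \<le> (\<Sum>e\<in>E. (edge_diff e f (x, \<eta>))\<^sup>2)"
        by (rule sum_mono2) (use flip_edge[OF x] in auto)
      finally show ?thesis .
    qed
    then show ?thesis unfolding S_def av_sum[symmetric] by (intro av_mono)
  qed
  have step: "av (\<lambda>z. (dir_diff i f z)\<^sup>2) \<le> 3 / p * av (\<lambda>z. is_open i z * (dir_diff i f z)\<^sup>2)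
      + 6 * (1 - p) * av (N i)" if i: "i < d" for i
  proof -
    have sq: "(a - b + c)\<^sup>2 \<le> 3 * (a\<^sup>2 + b\<^sup>2 + c\<^sup>2)" for a b c :: real
    proof -
      have "0 \<le> (a + b)\<^sup>2 + (b + c)\<^sup>2 + (a - c)\<^sup>2" by simp
      then show ?thesis by (simp add: power2_eq_square algebra_simps)
    qed
    have "av (\<lambda>z. (dir_diff i f z)\<^sup>2)
        \<le> av (\<lambda>z. 3 / p * (case z of (x, \<eta>) \<Rightarrow> p * (dir_diff i f (x, \<eta>({x, flip i x} := True)))\<^sup>2)
            + 3 * (1 - p) * (N i z + (case z of (x, \<eta>) \<Rightarrow> N i (flip i x, \<eta>))))"
      unfolding av_resample_edge[OF i, of "\<lambda>z. (dir_diff i f z)\<^sup>2"]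
    proof (rule av_mono, goal_cases)
      case (1 x \<eta>)
      let ?e = "{x, flip i x}"
      define a where "a = dir_diff i f (x, \<eta>(?e := True))"
      define b where "b = edge_diff ?e f (flip i x, \<eta>)"
      define c where "c = edge_diff ?e f (x, \<eta>)"
      \<comment> \<open>The three-step path: \<open>c\<close> opens the edge at \<open>x\<close>,
        \<open>a\<close> crosses it, and \<open>b\<close> with reversed sign closes it at the other
        end.\<close>
      have "dir_diff i f (x, \<eta>(?e := False)) = a - b + c"
        by (simp add: a_def b_def c_def dir_diff_def edge_diff_def)
      then have "(1 - p) * (dir_diff i f (x, \<eta>(?e := False)))\<^sup>2 \<le> (1 - p) * (3 * (a\<^sup>2 + b\<^sup>2 + c\<^sup>2))"
        using sq p by (intro mult_left_mono) auto
      moreover have "p * a\<^sup>2 + (1 - p) * (3 * a\<^sup>2) \<le> 3 * a\<^sup>2"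
        using p mult_nonneg_nonneg[of p "a\<^sup>2"] by (simp add: algebra_simps)
      moreover have N_eq: "N i (flip i x, \<eta>) = b\<^sup>2" "N i (x, \<eta>) = c\<^sup>2"
        using 1 i by (simp_all add: N_def b_def c_def flip_flip insert_commute)
      moreover have "(1 - p) * (3 * (a\<^sup>2 + b\<^sup>2 + c\<^sup>2))
          = (1 - p) * (3 * a\<^sup>2) + 3 * (1 - p) * (c\<^sup>2 + b\<^sup>2)"
        by (simp add: algebra_simps)
      moreover have "3 / p * (p * a\<^sup>2) = 3 * a\<^sup>2" using p by simp
      ultimately show ?case unfolding prod.case a_def[symmetric] N_eq by linarith
    qed
    also have "\<dots> = 3 / p * av (\<lambda>(x, \<eta>). p * (dir_diff i f (x, \<eta>({x, flip i x} := True)))\<^sup>2)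
         + 3 * (1 - p) * (av (N i) + av (N i))"
      by (simp only: av_add av_cmult av_flip[OF i])
    \<comment> \<open>\<open>is_open i\<close> annihilates the closed branch of the resampling,
      leaving the open branch with its weight \<open>p\<close>.\<close>
    also have "av (\<lambda>(x, \<eta>). p * (dir_diff i f (x, \<eta>({x, flip i x} := True)))\<^sup>2)
        = av (\<lambda>z. is_open i z * (dir_diff i f z)\<^sup>2)"
      unfolding av_resample_edge[OF i, of "\<lambda>z. is_open i z * (dir_diff i f z)\<^sup>2"]
      by (rule av_cong) (simp add: is_open_def)
    finally show ?thesis by (simp add: algebra_simps)
  qed
  have O0: "0 \<le> O'"
    unfolding O'_def by (intro sum_nonneg av_nonneg) (auto simp: is_open_def)
  have S0: "0 \<le> S"
    unfolding S_def by (intro sum_nonneg av_nonneg) auto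
  have "(\<Sum>i<d. av (\<lambda>z. (dir_diff i f z)\<^sup>2))
      \<le> (\<Sum>i<d. 3 / p * av (\<lambda>z. is_open i z * (dir_diff i f z)\<^sup>2) + 6 * (1 - p) * av (N i))"
    by (rule sum_mono) (use step in simp)
  also have "\<dots> = 3 / p * O' + 6 * (1 - p) * (\<Sum>i<d. av (N i))"
    by (simp add: sum.distrib sum_distrib_left O'_def)
  also have "\<dots> \<le> 3 / p * O' + 6 * (1 - p) * S"
    using N_sum p by simp
  finally have "\<mu> * p / (6 * d) * (\<Sum>i<d. av (\<lambda>z. (dir_diff i f z)\<^sup>2))
      \<le> \<mu> * p / (6 * d) * (3 / p * O' + 6 * (1 - p) * S)"
    using \<mu> p by (intro mult_left_mono) auto
  also have "\<dots> = \<mu> * (O' / (2 * d)) + (\<mu> * (p * (1 - p)) * S) / d"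
    using p d by (simp add: field_simps)
  \<comment> \<open>The walk part uses \<open>\<mu> \<le> 1\<close>, the refresh part
    \<open>d \<ge> 1\<close>.\<close>
  also have "\<dots> \<le> 1 * (O' / (2 * d)) + (\<mu> * (p * (1 - p)) * S) / 1"
    using \<mu> p d O0 S0 by (intro add_mono mult_right_mono divide_left_mono) auto
  finally show ?thesis
    by (simp add: dirichlet_def S_def O'_def power2_eq_square)
qed

end

section \<open>Solutions of Kolmogorov's equation\<close>

text \<open>Squaring smooths the kink of the negative part at 0, so that its energy can be
  differentiated in time.\<close>

lemma has_real_derivative_min_0_squared:
  "((\<lambda>x::real. (min x 0)\<^sup>2) has_real_derivative 2 * min x 0) (at x)"
proof -
  consider "x < 0" | "x > 0" | "x = 0" by linarith
  then show ?thesis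
  proof cases
    case 1
    have "((\<lambda>x::real. x\<^sup>2) has_real_derivative 2 * min x 0) (at x)"
      using 1 by (auto intro!: derivative_eq_intros)
    then show ?thesis
      by (rule has_field_derivative_transform_within_open[where S = "{..<0}"]) (use 1 in auto)
  next
    case 2
    have "((\<lambda>x::real. 0) has_real_derivative 2 * min x 0) (at x)"
      using 2 by (auto intro!: derivative_eq_intros)
    then show ?thesis
      by (rule has_field_derivative_transform_within_open[where S = "{0<..}"]) (use 2 in auto)
  next
    case 3
    have "(\<lambda>h::real. (min h 0)\<^sup>2 / h) \<midarrow>0\<rightarrow> 0"
    proof (rule Lim_null_comparison)
      show "\<forall>\<^sub>F h::real in at 0. norm ((min h 0)\<^sup>2 / h) \<le> \<bar>h\<bar>"
        by (rule always_eventually) (auto simp: min_def power2_eq_square)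
      show "(\<lambda>h::real. \<bar>h\<bar>) \<midarrow>0\<rightarrow> 0" by (intro tendsto_eq_intros) auto
    qed
    then show ?thesis using 3 by (simp add: DERIV_def)
  qed
qed

context percolation_cube
begin

text \<open>Negative times are included so that conserved quantities are constant on the whole line,
  also after a time reversal.\<close>

definition kolmogorov_solution :: "(real \<Rightarrow> (nat \<Rightarrow> nat) full_state \<Rightarrow> real) \<Rightarrow> bool" where
  "kolmogorov_solution U \<longleftrightarrow> (\<forall>t. \<forall>z\<in>full_states V E.
      ((\<lambda>t. U t z) has_real_derivative L (U t) z) (at t))"

lemma kolmogorov_solutionD:
  "kolmogorov_solution U \<Longrightarrow> x \<in> V \<Longrightarrow> \<eta> \<in> Env \<Longrightarrow>
    ((\<lambda>t. U t (x, \<eta>)) has_real_derivative L (U t) (x, \<eta>)) (at t)"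
  by (simp add: kolmogorov_solution_def states_iff)

lemma av_has_derivative:
  assumes "\<And>x \<eta>. x \<in> V \<Longrightarrow> \<eta> \<in> Env \<Longrightarrow> ((\<lambda>t. F t (x, \<eta>)) has_real_derivative F' (x, \<eta>)) (at t)"
  shows "((\<lambda>t. av (F t)) has_real_derivative av F') (at t)"
  unfolding av_def by (intro DERIV_cdivide DERIV_sum DERIV_cmult assms)

lemma generator_linear:
  assumes "x \<in> V" "\<eta> \<in> Env"
  shows "L (\<lambda>z. a * f z + b * g z) (x, \<eta>) = a * L f (x, \<eta>) + b * L g (x, \<eta>)"
proof -
  have "(\<Sum>e\<in>E. \<mu> * (p * ((a * f (x, \<eta>(e := True)) + b * g (x, \<eta>(e := True))) - (a * f (x, \<eta>) + b * g (x, \<eta>)))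
      + (1 - p) * ((a * f (x, \<eta>(e := False)) + b * g (x, \<eta>(e := False))) - (a * f (x, \<eta>) + b * g (x, \<eta>)))))
    = a * (\<Sum>e\<in>E. \<mu> * (p * (f (x, \<eta>(e := True)) - f (x, \<eta>)) + (1 - p) * (f (x, \<eta>(e := False)) - f (x, \<eta>))))
    + b * (\<Sum>e\<in>E. \<mu> * (p * (g (x, \<eta>(e := True)) - g (x, \<eta>)) + (1 - p) * (g (x, \<eta>(e := False)) - g (x, \<eta>))))"
    unfolding sum_distrib_left sum.distrib[symmetric] by (rule sum.cong) (simp_all add: algebra_simps)
  moreover have "(\<Sum>i<d. is_open i (x, \<eta>) * dir_diff i (\<lambda>z. a * f z + b * g z) (x, \<eta>))
      = a * (\<Sum>i<d. is_open i (x, \<eta>) * dir_diff i f (x, \<eta>)) + b * (\<Sum>i<d. is_open i (x, \<eta>) * dir_diff i g (x, \<eta>))"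
    unfolding sum_distrib_left sum.distrib[symmetric]
    by (rule sum.cong) (simp_all add: dir_diff_def algebra_simps)
  ultimately show ?thesis
    unfolding generator_cube[OF assms(1)] by (simp add: add_divide_distrib distrib_left)
qed

lemma kolmogorov_solution_linear:
  assumes "kolmogorov_solution U" "kolmogorov_solution W"
  shows "kolmogorov_solution (\<lambda>t z. a * U t z + b * W t z)"
  unfolding kolmogorov_solution_def
proof (intro allI ballI)
  fix t z assume "z \<in> full_states V E"
  then obtain x \<eta> where z: "z = (x, \<eta>)" "x \<in> V" "\<eta> \<in> Env" by (auto simp: full_states_def)
  show "((\<lambda>t. a * U t z + b * W t z) has_real_derivative L (\<lambda>z. a * U t z + b * W t z) z) (at t)"
    unfolding z(1) generator_linear[OF z(2,3)]
    by (intro DERIV_add DERIV_cmult kolmogorov_solutionD assms z)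
qed

text \<open>Maximum principle by an energy argument. The mean square of the negative part has
  derivative \<open>- 2 * dirichlet (U t) (N t)\<close>, which is at most 0 since truncation is
  monotone, and it starts at 0.\<close>

lemma kolmogorov_nonneg:
  assumes U: "kolmogorov_solution U" and U0: "\<And>x \<eta>. x \<in> V \<Longrightarrow> \<eta> \<in> Env \<Longrightarrow> 0 \<le> U 0 (x, \<eta>)"
    and t: "0 \<le> t" and x: "x \<in> V" "\<eta> \<in> Env"
  shows "0 \<le> U t (x, \<eta>)"
proof -
  define N where "N = (\<lambda>t z. min (U t z) 0)"
  have der: "((\<lambda>t. av (\<lambda>z. (N t z)\<^sup>2)) has_real_derivative - 2 * dirichlet (U t) (N t)) (at t)" for t
  proof -
    have "((\<lambda>t. av (\<lambda>z. (N t z)\<^sup>2)) has_real_derivative av (\<lambda>z. 2 * (N t z * L (U t) z))) (at t)"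
      unfolding N_def
      by (rule av_has_derivative)
         (use DERIV_chain2[OF has_real_derivative_min_0_squared kolmogorov_solutionD[OF U]]
          in \<open>simp add: mult.assoc\<close>)
    then show ?thesis unfolding av_cmult av_generator by simp
  qed
  have min_mono: "0 \<le> (a - b) * (min a 0 - min b 0)" for a b :: real
    by (cases "a \<le> b") (auto intro!: mult_nonneg_nonneg mult_nonpos_nonpos simp: min_def)
  have "0 \<le> av (\<lambda>z. edge_diff e (U t) z * edge_diff e (N t) z)" for e t
    by (rule av_nonneg) (simp add: edge_diff_def N_def min_mono)
  moreover have "0 \<le> av (\<lambda>z. is_open i z * (dir_diff i (U t) z * dir_diff i (N t) z))" for i t
    by (rule av_nonneg) (simp add: dir_diff_def is_open_def N_def min_mono)
  ultimately have nonneg: "0 \<le> dirichlet (U t) (N t)" for t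
    unfolding dirichlet_def
    by (intro add_nonneg_nonneg mult_nonneg_nonneg divide_nonneg_nonneg sum_nonneg)
       (use \<mu> p in auto)
  have "av (\<lambda>z. (N t z)\<^sup>2) \<le> av (\<lambda>z. (N 0 z)\<^sup>2)"
    by (rule DERIV_nonpos_imp_nonincreasing[OF t], intro exI conjI, rule der) (use nonneg in simp)
  also have "\<dots> = av (\<lambda>_. 0)"
    by (rule av_cong) (use U0 in \<open>simp add: N_def\<close>)
  finally have "(\<Sum>x\<in>V. \<Sum>\<eta>\<in>Env. wt \<eta> * (N t (x, \<eta>))\<^sup>2) \<le> 0"
    by (simp add: av_def field_simps)
  \<comment> \<open>All weights are positive, so a vanishing mean square forces the negative part to
    vanish at every state.\<close>
  moreover have nn: "0 \<le> wt \<eta> * (N t (x, \<eta>))\<^sup>2" for x \<eta>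
    using wt_pos[of \<eta>] by simp
  ultimately have "(\<Sum>x\<in>V. \<Sum>\<eta>\<in>Env. wt \<eta> * (N t (x, \<eta>))\<^sup>2) = 0"
    by (intro order_antisym sum_nonneg) auto
  then have "\<forall>x\<in>V. (\<Sum>\<eta>\<in>Env. wt \<eta> * (N t (x, \<eta>))\<^sup>2) = 0"
    by (subst (asm) sum_nonneg_eq_0_iff) (use nn in \<open>auto intro!: sum_nonneg\<close>)
  then have "(\<Sum>\<eta>\<in>Env. wt \<eta> * (N t (x, \<eta>))\<^sup>2) = 0" using x by blast
  then have "\<forall>\<eta>\<in>Env. wt \<eta> * (N t (x, \<eta>))\<^sup>2 = 0"
    by (subst (asm) sum_nonneg_eq_0_iff) (use nn in auto)
  then have "wt \<eta> * (N t (x, \<eta>))\<^sup>2 = 0" using x by blast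
  then have "N t (x, \<eta>) = 0" using wt_pos[of \<eta>] by simp
  then show ?thesis by (simp add: N_def min_def split: if_splits)
qed

text \<open>Both differences solve the equation with initial value 0, so positivity applies to
  each.\<close>

lemma kolmogorov_unique:
  assumes U: "kolmogorov_solution U" and W: "kolmogorov_solution W"
    and eq: "\<And>x \<eta>. x \<in> V \<Longrightarrow> \<eta> \<in> Env \<Longrightarrow> U 0 (x, \<eta>) = W 0 (x, \<eta>)"
    and t: "0 \<le> t" and x: "x \<in> V" "\<eta> \<in> Env"
  shows "U t (x, \<eta>) = W t (x, \<eta>)"
proof -
  have "0 \<le> 1 * U t (x, \<eta>) + (-1) * W t (x, \<eta>)"
    by (rule kolmogorov_nonneg[OF kolmogorov_solution_linear[OF U W] _ t x]) (simp add: eq)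
  moreover have "0 \<le> 1 * W t (x, \<eta>) + (-1) * U t (x, \<eta>)"
    by (rule kolmogorov_nonneg[OF kolmogorov_solution_linear[OF W U] _ t x]) (simp add: eq)
  ultimately show ?thesis by simp
qed

lemma generator_sums:
  assumes F: "\<And>x \<eta>. x \<in> V \<Longrightarrow> \<eta> \<in> Env \<Longrightarrow> (\<lambda>n. F n (x, \<eta>)) sums G (x, \<eta>)"
    and x: "x \<in> V" "\<eta> \<in> Env"
  shows "(\<lambda>n. L (F n) (x, \<eta>)) sums L G (x, \<eta>)"
  unfolding generator_cube[OF x(1)] dir_diff_def prod.case
  by (intro sums_add sums_sum sums_mult sums_diff sums_divide; rule F)
     (use x upd_Env flip_in_verts in auto)

text \<open>At a state the generator is a finite linear combination of values of the function, so it
  passes through the exponential series term by term.\<close>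

lemma generator_semigroup:
  assumes z: "x \<in> V" "\<eta> \<in> Env"
  shows "full_semigroup V E \<mu> p t (L f) (x, \<eta>) = L (full_semigroup V E \<mu> p t f) (x, \<eta>)"
proof -
  have "(\<lambda>n. t ^ n / fact n * (L ^^ n) f (x, \<eta>)) sums full_semigroup V E \<mu> p t f (x, \<eta>)"
    if "x \<in> V" "\<eta> \<in> Env" for x \<eta>
    using full_semigroup_summable[of V E "(x, \<eta>)" \<mu> p f t] that
    by (simp add: full_semigroup_def summable_sums mult.commute states_iff)
  from generator_sums[where F = "\<lambda>n w. t ^ n / fact n * (L ^^ n) f w"
      and G = "full_semigroup V E \<mu> p t f", OF this z]
  have "(\<lambda>n. L (\<lambda>w. t ^ n / fact n * (L ^^ n) f w) (x, \<eta>)) sums L (full_semigroup V E \<mu> p t f) (x, \<eta>)" .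
  moreover have "L (\<lambda>w. t ^ n / fact n * (L ^^ n) f w) (x, \<eta>) = t ^ n / fact n * (L ^^ n) (L f) (x, \<eta>)" for n
    using generator_linear[OF z, of "t ^ n / fact n" "(L ^^ n) f" 0 "\<lambda>_. 0"] by (simp add: funpow_swap1)
  ultimately show ?thesis by (simp add: full_semigroup_def sums_iff)
qed

lemma kolmogorov_semigroup: "kolmogorov_solution (\<lambda>t. full_semigroup V E \<mu> p t f)"
  unfolding kolmogorov_solution_def
proof (intro allI ballI)
  fix t z assume z: "z \<in> full_states V E"
  obtain x \<eta> where [simp]: "z = (x, \<eta>)" by fastforce
  show "((\<lambda>t. full_semigroup V E \<mu> p t f z) has_real_derivative L (full_semigroup V E \<mu> p t f) z) (at t)"
    using full_semigroup_kolmogorov[of V E z \<mu> p f t] z generator_semigroup[of x \<eta> t f]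
    by (simp add: states_iff)
qed

section \<open>Densities with respect to the stationary distribution, and reversibility\<close>

lemma pi_full_cube:
  assumes "x \<in> V" "\<eta> \<in> Env"
  shows "pi_full V E p (x, \<eta>) = wt \<eta> / 2 ^ d"
proof -
  have "pmf (Pi_pmf E undefined (\<lambda>_. bernoulli_pmf p)) \<eta> = (\<Prod>e\<in>E. pmf (bernoulli_pmf p) (\<eta> e))"
    using assms(2) by (intro pmf_Pi') (auto simp: PiE_iff extensional_def)
  also have "\<dots> = wt \<eta>"
    unfolding wt_def using p by (intro prod.cong) auto
  finally have "pmf (Pi_pmf E undefined (\<lambda>_. bernoulli_pmf p)) \<eta> = wt \<eta>" .
  moreover have "2 * real (card E) = d * 2 ^ d"
    using arg_cong[OF card_hypercube_edges[of d], of real] by simp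
  ultimately show ?thesis
    using assms(1) d by (simp add: pi_full_def vertex_degree_hypercube)
qed

text \<open>The target \<open>w\<close> is fixed and the start \<open>z\<close> varies, so the
  backward equation applies. By reversibility this is also the density at \<open>z\<close> of the
  chain started in \<open>w\<close>.\<close>

definition density :: "(nat \<Rightarrow> nat) full_state \<Rightarrow> real \<Rightarrow> (nat \<Rightarrow> nat) full_state \<Rightarrow> real" where
  "density w t z = full_semigroup V E \<mu> p t (indicator {w}) z / pi_full V E p w"

lemma kolmogorov_density: "kolmogorov_solution (density w)"
  using kolmogorov_solution_linear[OF kolmogorov_semigroup kolmogorov_semigroup,
      of "1 / pi_full V E p w" "indicator {w}" 0]
  by (simp add: density_def[abs_def])

lemma density_0:
  assumes "y \<in> V" "\<zeta> \<in> Env"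
  shows "density (y, \<zeta>) 0 (x, \<eta>) = (if x = y \<and> \<eta> = \<zeta> then 2 ^ d / wt \<zeta> else 0)"
  by (simp add: density_def full_semigroup_0 pi_full_cube[OF assms] indicator_def)

lemma av_density_0:
  assumes "y \<in> V" "\<zeta> \<in> Env"
  shows "av (\<lambda>z. density (y, \<zeta>) 0 z * F z) = F (y, \<zeta>)"
proof -
  have "(\<Sum>\<eta>\<in>Env. wt \<eta> * (density (y, \<zeta>) 0 (x, \<eta>) * F (x, \<eta>)))
      = (if x = y then 2 ^ d * F (y, \<zeta>) else 0)" for x
  proof -
    have "(\<Sum>\<eta>\<in>Env. wt \<eta> * (density (y, \<zeta>) 0 (x, \<eta>) * F (x, \<eta>)))
        = (\<Sum>\<eta>\<in>Env. if \<eta> = \<zeta> then if x = y then 2 ^ d * F (y, \<zeta>) else 0 else 0)"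
      by (rule sum.cong) (use wt_pos[of \<zeta>] in \<open>simp_all add: density_0[OF assms]\<close>)
    then show ?thesis using assms(2) by (simp only: sum.delta finite_Env if_True)
  qed
  then show ?thesis using assms(1) by (simp add: av_def)
qed

lemma density_nonneg:
  assumes "y \<in> V" "\<zeta> \<in> Env" "0 \<le> t" "x \<in> V" "\<eta> \<in> Env"
  shows "0 \<le> density (y, \<zeta>) t (x, \<eta>)"
  by (rule kolmogorov_nonneg[OF kolmogorov_density _ assms(3-5)])
     (use wt_pos[of \<zeta>] in \<open>simp add: density_0[OF assms(1,2)]\<close>)

text \<open>Conservation of mass: the equation is tested against the constant 1, whose differences
  vanish.\<close>

lemma av_density:
  assumes "y \<in> V" "\<zeta> \<in> Env"
  shows "av (density (y, \<zeta>) t) = 1"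
proof -
  let ?U = "density (y, \<zeta>)"
  have "((\<lambda>t. av (?U t)) has_real_derivative 0) (at t)" for t
  proof -
    have "((\<lambda>t. av (?U t)) has_real_derivative av (\<lambda>z. 1 * L (?U t) z)) (at t)"
      by (rule av_has_derivative) (use kolmogorov_solutionD[OF kolmogorov_density] in simp)
    also have "av (\<lambda>z. 1 * L (?U t) z) = 0"
      unfolding av_generator by (simp add: dirichlet_def edge_diff_def dir_diff_def case_prod_unfold av_const)
    finally show ?thesis .
  qed
  then have "av (?U t) = av (?U 0)" by (intro DERIV_isconst_all) auto
  then show ?thesis using av_density_0[OF assms, of "\<lambda>_. 1"] by simp
qed

text \<open>Reversibility makes \<open>s \<mapsto> av (U s \<cdot> W (2 t - s))\<close> constant.\<close>

lemma density_split:
  assumes y: "y \<in> V" "\<zeta> \<in> Env" and y': "y' \<in> V" "\<zeta>' \<in> Env"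
  shows "density (y', \<zeta>') (2 * t) (y, \<zeta>) = av (\<lambda>z. density (y, \<zeta>) t z * density (y', \<zeta>') t z)"
proof -
  define U where "U = density (y, \<zeta>)"
  define W where "W = density (y', \<zeta>')"
  define G where "G = (\<lambda>s. av (\<lambda>z. U s z * W (2 * t - s) z))"
  have "(G has_real_derivative 0) (at s)" for s
  proof -
    have "(G has_real_derivative av (\<lambda>z. W (2 * t - s) z * L (U s) z - U s z * L (W (2 * t - s)) z)) (at s)"
      unfolding G_def
    proof (rule av_has_derivative, goal_cases)
      case (1 x \<eta>)
      have "((\<lambda>s. W (2 * t - s) (x, \<eta>)) has_real_derivative L (W (2 * t - s)) (x, \<eta>) * (-1)) (at s)"
        by (rule DERIV_chain2[of "\<lambda>s. W s (x, \<eta>)"])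
           (auto intro!: derivative_eq_intros kolmogorov_solutionD kolmogorov_density 1 simp: W_def)
      moreover have "((\<lambda>s. U s (x, \<eta>)) has_real_derivative L (U s) (x, \<eta>)) (at s)"
        unfolding U_def by (intro kolmogorov_solutionD kolmogorov_density 1)
      ultimately show ?case
        by (auto intro!: derivative_eq_intros simp: algebra_simps)
    qed
    also have "av (\<lambda>z. W (2 * t - s) z * L (U s) z - U s z * L (W (2 * t - s)) z) = 0"
      unfolding av_diff av_generator using dirichlet_sym by simp
    finally show ?thesis .
  qed
  then have "G 0 = G t" by (intro DERIV_isconst_all) auto
  then show ?thesis
    unfolding G_def U_def using av_density_0[OF y] by (simp add: W_def)
qed

section \<open>The environment marginal\<close>

text \<open>The density with respect to Bernoulli(\<open>p\<close>) of a single edge at time \<open>t\<close>, started from \<open>\<zeta> e\<close>.\<close>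

definition edge_factor :: "((nat \<Rightarrow> nat) set \<Rightarrow> bool) \<Rightarrow> real \<Rightarrow> (nat \<Rightarrow> nat) set \<Rightarrow> bool \<Rightarrow> real" where
  "edge_factor \<zeta> t e c = 1 + exp (- \<mu> * t) * ((if c = \<zeta> e then 1 / (if c then p else 1 - p) else 0) - 1)"

text \<open>The edges refresh independently. Each factor has Bernoulli(\<open>p\<close>) mean 1, so
  a refresh replaces it by 1, in agreement with its exponential relaxation to 1; the walk sees a
  function that is constant in \<open>x\<close>.\<close>

lemma kolmogorov_environment:
  "kolmogorov_solution (\<lambda>t (x, \<eta>). \<Prod>e\<in>E. edge_factor \<zeta> t e (\<eta> e))"
  unfolding kolmogorov_solution_def
proof (intro allI ballI)
  fix t z assume "z \<in> full_states V E"
  then obtain x \<eta> where z: "z = (x, \<eta>)" "x \<in> V" "\<eta> \<in> Env" by (auto simp: full_states_def)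
  define Q where "Q = (\<lambda>\<eta>. \<Prod>e\<in>E. edge_factor \<zeta> t e (\<eta> e))"
  define R where "R = (\<lambda>e. \<Prod>e'\<in>E - {e}. edge_factor \<zeta> t e' (\<eta> e'))"
  have Q_upd: "Q (\<eta>(e := c)) = edge_factor \<zeta> t e c * R e" if "e \<in> E" for e c
    unfolding Q_def R_def using that by (subst prod.remove[of _ e]) (auto intro!: prod.cong)
  have Q: "Q \<eta> = edge_factor \<zeta> t e (\<eta> e) * R e" if "e \<in> E" for e
    using Q_upd[OF that, of "\<eta> e"] by simp
  have mean: "p * edge_factor \<zeta> t e True + (1 - p) * edge_factor \<zeta> t e False = 1" for e
    using p by (auto simp: edge_factor_def field_simps)
  have "((\<lambda>t. \<Prod>e\<in>E. edge_factor \<zeta> t e (\<eta> e)) has_real_derivative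
      (\<Sum>e\<in>E. \<mu> * (1 - edge_factor \<zeta> t e (\<eta> e)) * R e)) (at t)"
    unfolding R_def
    by (rule has_field_derivative_prod) (auto simp: edge_factor_def intro!: derivative_eq_intros)
  moreover have "L (\<lambda>(x, \<eta>). Q \<eta>) (x, \<eta>) = (\<Sum>e\<in>E. \<mu> * (1 - edge_factor \<zeta> t e (\<eta> e)) * R e)"
  proof -
    have "p * (Q (\<eta>(e := True)) - Q \<eta>) + (1 - p) * (Q (\<eta>(e := False)) - Q \<eta>)
        = (1 - edge_factor \<zeta> t e (\<eta> e)) * R e" if "e \<in> E" for e
    proof -
      have "p * (Q (\<eta>(e := True)) - Q \<eta>) + (1 - p) * (Q (\<eta>(e := False)) - Q \<eta>)
          = (p * edge_factor \<zeta> t e True + (1 - p) * edge_factor \<zeta> t e False - edge_factor \<zeta> t e (\<eta> e)) * R e"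
        unfolding Q_upd[OF that] Q[OF that] by (simp add: algebra_simps)
      then show ?thesis by (simp only: mean)
    qed
    then show ?thesis
      unfolding generator_cube[OF z(2)] by (simp add: dir_diff_def mult.assoc)
  qed
  ultimately show "((\<lambda>t. case z of (x, \<eta>) \<Rightarrow> \<Prod>e\<in>E. edge_factor \<zeta> t e (\<eta> e)) has_real_derivative
      L (\<lambda>(x, \<eta>). \<Prod>e\<in>E. edge_factor \<zeta> t e (\<eta> e)) z) (at t)"
    by (simp add: z(1) Q_def)
qed

text \<open>The environment evolves autonomously: summed over positions, the walk terms cancel in
  pairs across each edge.\<close>

lemma kolmogorov_marginal:
  assumes U: "kolmogorov_solution U"
  shows "kolmogorov_solution (\<lambda>t (x, \<eta>). \<Sum>x'\<in>V. U t (x', \<eta>))"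
  unfolding kolmogorov_solution_def
proof (intro allI ballI)
  fix t z assume "z \<in> full_states V E"
  then obtain x \<eta> where z: "z = (x, \<eta>)" "x \<in> V" "\<eta> \<in> Env" by (auto simp: full_states_def)
  have walk: "(\<Sum>x'\<in>V. is_open i (x', \<eta>) * dir_diff i (U t) (x', \<eta>)) = 0" if i: "i < d" for i
  proof -
    let ?G = "\<lambda>x'. is_open i (x', \<eta>) * dir_diff i (U t) (x', \<eta>)"
    have "(\<Sum>x'\<in>V. ?G x') = (\<Sum>x'\<in>V. ?G (flip i x'))"
      by (rule sum_flip[OF i, symmetric])
    also have "\<dots> = (\<Sum>x'\<in>V. - ?G x')"
      by (rule sum.cong) (auto simp: is_open_def dir_diff_def flip_flip i insert_commute)
    finally show ?thesis by (simp add: sum_negf)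
  qed
  have walk0: "(\<Sum>x'\<in>V. (\<Sum>i<d. is_open i (x', \<eta>) * dir_diff i (U t) (x', \<eta>)) / d) = 0"
  proof -
    have "(\<Sum>x'\<in>V. \<Sum>i<d. is_open i (x', \<eta>) * dir_diff i (U t) (x', \<eta>)) = 0"
      by (subst sum.swap) (simp add: walk)
    then show ?thesis by (simp add: sum_divide_distrib[symmetric])
  qed
  have "(\<Sum>x'\<in>V. L (U t) (x', \<eta>)) = (\<Sum>x'\<in>V. \<Sum>e\<in>E. \<mu> * (p * (U t (x', \<eta>(e := True)) - U t (x', \<eta>))
                  + (1 - p) * (U t (x', \<eta>(e := False)) - U t (x', \<eta>))))"
    by (simp add: generator_cube sum.distrib walk0)
  also have "\<dots> = L (\<lambda>(x, \<eta>). \<Sum>x'\<in>V. U t (x', \<eta>)) (x, \<eta>)"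
    by (subst sum.swap)
       (simp add: generator_cube z dir_diff_def sum_distrib_left sum.distrib[symmetric]
         sum_subtractf[symmetric] right_diff_distrib)
  finally have eq: "(\<Sum>x'\<in>V. L (U t) (x', \<eta>)) = L (\<lambda>(x, \<eta>). \<Sum>x'\<in>V. U t (x', \<eta>)) (x, \<eta>)" .
  show "((\<lambda>t. case z of (x, \<eta>) \<Rightarrow> \<Sum>x'\<in>V. U t (x', \<eta>)) has_real_derivative
      L (\<lambda>(x, \<eta>). \<Sum>x'\<in>V. U t (x', \<eta>)) z) (at t)"
    unfolding z(1) prod.case eq[symmetric]
    by (intro DERIV_sum kolmogorov_solutionD[OF U] z)
qed

text \<open>By uniqueness only time 0 has to be compared: the product is
  \<open>1 / wt \<zeta>\<close> if \<open>\<eta> = \<zeta>\<close>, and otherwise some factor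
  vanishes.\<close>

lemma density_marginal:
  assumes y: "y \<in> V" "\<zeta> \<in> Env" and t: "0 \<le> t" and \<eta>: "\<eta> \<in> Env"
  shows "(\<Sum>x\<in>V. density (y, \<zeta>) t (x, \<eta>)) = 2 ^ d * (\<Prod>e\<in>E. edge_factor \<zeta> t e (\<eta> e))"
proof -
  have "(case (y, \<eta>) of (x, \<eta>) \<Rightarrow> \<Sum>x\<in>V. density (y, \<zeta>) t (x, \<eta>))
      = 2 ^ d * (case (y, \<eta>) of (x, \<eta>) \<Rightarrow> \<Prod>e\<in>E. edge_factor \<zeta> t e (\<eta> e))
        + 0 * (case (y, \<eta>) of (x, \<eta>) \<Rightarrow> \<Prod>e\<in>E. edge_factor \<zeta> t e (\<eta> e))"
  proof (rule kolmogorov_unique[OF kolmogorov_marginal[OF kolmogorov_density]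
        kolmogorov_solution_linear[OF kolmogorov_environment kolmogorov_environment] _ t y(1) \<eta>])
    fix x \<eta> assume "\<eta> \<in> Env"
    have "(\<Sum>x\<in>V. density (y, \<zeta>) 0 (x, \<eta>)) = 2 ^ d * (\<Prod>e\<in>E. edge_factor \<zeta> 0 e (\<eta> e))"
    proof (cases "\<eta> = \<zeta>")
      case True
      have "(\<Prod>e\<in>E. edge_factor \<zeta> 0 e (\<eta> e)) = 1 / wt \<zeta>"
        unfolding True wt_def by (simp add: edge_factor_def prod_dividef)
      then show ?thesis using y True by (simp add: density_0 if_distrib cong: if_cong)
    next
      case False
      then obtain e where "e \<in> E" "\<eta> e \<noteq> \<zeta> e"
        using PiE_ext[OF \<open>\<eta> \<in> Env\<close> y(2)] by blast
      then have "(\<Prod>e\<in>E. edge_factor \<zeta> 0 e (\<eta> e)) = 0"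
        by (intro prod_zero bexI[of _ e]) (simp_all add: edge_factor_def)
      then show ?thesis using y False by (simp add: density_0)
    qed
    then show "(case (x, \<eta>) of (x, \<eta>) \<Rightarrow> \<Sum>x\<in>V. density (y, \<zeta>) 0 (x, \<eta>))
      = 2 ^ d * (case (x, \<eta>) of (x, \<eta>) \<Rightarrow> \<Prod>e\<in>E. edge_factor \<zeta> 0 e (\<eta> e))
        + 0 * (case (x, \<eta>) of (x, \<eta>) \<Rightarrow> \<Prod>e\<in>E. edge_factor \<zeta> 0 e (\<eta> e))"
      by simp
  qed
  then show ?thesis by simp
qed

text \<open>Both \<open>1 / p\<close> and \<open>1 / (1 - p)\<close> are at most
  \<open>1 / (p * (1 - p))\<close>, so each edge factor is at most \<open>1 + r \<le> exp r\<close>,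
  and the product over the edges is at most \<open>exp (card E * r)\<close>.\<close>

lemma density_marginal_le:
  assumes y: "y \<in> V" "\<zeta> \<in> Env" and t: "0 \<le> t" and \<eta>: "\<eta> \<in> Env"
    and M: "0 < M" "card E * (exp (- \<mu> * t) / (p * (1 - p))) \<le> ln M"
  shows "(\<Sum>x\<in>V. density (y, \<zeta>) t (x, \<eta>)) \<le> 2 ^ d * M"
proof -
  define r where "r = exp (- \<mu> * t) / (p * (1 - p))"
  have r: "0 \<le> r" using p by (simp add: r_def)
  have e1: "exp (- \<mu> * t) \<le> 1" using t \<mu> by simp
  have fac: "0 \<le> edge_factor \<zeta> t e c" "edge_factor \<zeta> t e c \<le> 1 + r" for e c
  proof -
    define k where "k = (if c = \<zeta> e then 1 / (if c then p else 1 - p) else 0)"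
    have k: "0 \<le> k" "k \<le> 1 / (p * (1 - p))"
      using p mult_left_le[of "1 - p" p] mult_left_le_one_le[of "1 - p" p]
      by (auto simp: k_def intro!: divide_left_mono)
    have ef: "edge_factor \<zeta> t e c = 1 - exp (- \<mu> * t) + exp (- \<mu> * t) * k"
      by (simp add: edge_factor_def k_def algebra_simps)
    show "0 \<le> edge_factor \<zeta> t e c"
      unfolding ef using e1 k by simp
    have "exp (- \<mu> * t) * k \<le> r"
      using mult_left_mono[OF k(2), of "exp (- \<mu> * t)"] by (simp add: r_def)
    then show "edge_factor \<zeta> t e c \<le> 1 + r"
      unfolding ef using exp_ge_zero[of "- \<mu> * t"] by linarith
  qed
  have "(\<Prod>e\<in>E. edge_factor \<zeta> t e (\<eta> e)) \<le> (\<Prod>e\<in>E. exp r)"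
    using fac order_trans[OF fac(2) exp_ge_add_one_self] by (intro prod_mono) auto
  also have "\<dots> = exp (card E * r)" by (simp add: exp_of_nat_mult)
  also have "\<dots> \<le> exp (ln M)" using M(2) unfolding exp_le_cancel_iff r_def .
  finally show ?thesis using M by (simp add: density_marginal[OF y t \<eta>])
qed

end

section \<open>Decay of the second moment and uniform mixing\<close>

context percolation_cube
begin

text \<open>The Nash inequality is applied in each frozen environment, where it involves the local
  second moment \<open>a \<eta>\<close>; averaging over environments then yields the global
  \<open>u\<close>.\<close>

lemma log_Sobolev_bounded_marginal:
  assumes nonneg: "\<And>x \<eta>. x \<in> V \<Longrightarrow> \<eta> \<in> Env \<Longrightarrow> 0 \<le> f (x, \<eta>)"
    and marginal: "\<And>\<eta>. \<eta> \<in> Env \<Longrightarrow> (\<Sum>x\<in>V. f (x, \<eta>)) \<le> 2 ^ d * M" and M: "0 < M"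
    and u: "u = av (\<lambda>z. (f z)\<^sup>2)" "0 < u"
  shows "u * (ln u - 2 * ln M) \<le> (\<Sum>i<d. av (\<lambda>z. (dir_diff i f z)\<^sup>2))"
proof -
  define a where "a = (\<lambda>\<eta>. (\<Sum>x\<in>V. (f (x, \<eta>))\<^sup>2) / 2 ^ d)"
  define W where "W = (\<lambda>\<eta>. (\<Sum>i<d. \<Sum>x\<in>V. (dir_diff i f (x, \<eta>))\<^sup>2) / 2 ^ d)"
  have u_eq: "u = (\<Sum>\<eta>\<in>Env. wt \<eta> * a \<eta>)"
    unfolding u(1) av_def a_def by (subst sum.swap) (simp add: sum_distrib_left sum_divide_distrib)
  have W_eq: "(\<Sum>i<d. av (\<lambda>z. (dir_diff i f z)\<^sup>2)) = (\<Sum>\<eta>\<in>Env. wt \<eta> * W \<eta>)"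
  proof -
    have "av (\<lambda>z. (dir_diff i f z)\<^sup>2) = (\<Sum>\<eta>\<in>Env. wt \<eta> * ((\<Sum>x\<in>V. (dir_diff i f (x, \<eta>))\<^sup>2) / 2 ^ d))" for i
      unfolding av_def by (subst sum.swap) (simp add: sum_distrib_left sum_divide_distrib)
    then show ?thesis
      unfolding W_def by (simp only:, subst sum.swap) (simp add: sum_distrib_left sum_divide_distrib)
  qed
  have "wt \<eta> * (a \<eta> * (ln u - 2 * ln M) + a \<eta> - u) \<le> wt \<eta> * W \<eta>" if \<eta>: "\<eta> \<in> Env" for \<eta>
  proof (rule mult_left_mono[OF _ less_imp_le[OF wt_pos]])
    have "(\<Sum>x\<in>V. (f (x, \<eta>))\<^sup>2) * (ln ((\<Sum>x\<in>V. (f (x, \<eta>))\<^sup>2) / 2 ^ d) - 2 * ln M)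
        \<le> (\<Sum>i<d. \<Sum>x\<in>V. (f (flip i x, \<eta>) - f (x, \<eta>))\<^sup>2)"
      by (rule hypercube_Nash[where f = "\<lambda>x. f (x, \<eta>)"]) (use nonneg marginal M \<eta> in auto)
    from divide_right_mono[OF this, of "2 ^ d"] have "a \<eta> * (ln (a \<eta>) - 2 * ln M) \<le> W \<eta>"
      by (simp add: a_def W_def dir_diff_def)
    \<comment> \<open>This exchanges \<open>ln (a \<eta>)\<close> for \<open>ln u\<close>; the cost
      \<open>a \<eta> - u\<close> has mean 0.\<close>
    moreover have "a \<eta> - u \<le> a \<eta> * (ln (a \<eta>) - ln u)"
      by (rule mult_ln_ratio_le) (use u in \<open>auto simp: a_def intro!: sum_nonneg divide_nonneg_nonneg\<close>)
    ultimately show "a \<eta> * (ln u - 2 * ln M) + a \<eta> - u \<le> W \<eta>"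
      by (simp add: algebra_simps)
  qed
  then have "(\<Sum>\<eta>\<in>Env. wt \<eta> * (a \<eta> * (ln u - 2 * ln M) + a \<eta> - u)) \<le> (\<Sum>\<eta>\<in>Env. wt \<eta> * W \<eta>)"
    by (rule sum_mono)
  also have "(\<Sum>\<eta>\<in>Env. wt \<eta> * (a \<eta> * (ln u - 2 * ln M) + a \<eta> - u))
      = (\<Sum>\<eta>\<in>Env. wt \<eta> * a \<eta>) * (ln u - 2 * ln M) + (\<Sum>\<eta>\<in>Env. wt \<eta> * a \<eta>) - (\<Sum>\<eta>\<in>Env. wt \<eta>) * u"
    by (simp add: sum_distrib_left sum_distrib_right sum.distrib[symmetric] sum_subtractf[symmetric] algebra_simps)
  finally show ?thesis
    unfolding u_eq[symmetric] W_eq sum_wt by simp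
qed

text \<open>The energy inequality becomes a linear differential inequality for
  \<open>ln (u t)\<close>, solved from time \<open>T\<close> on. The initial excess is only
  \<open>d * ln 2\<close>, independent of \<open>p\<close>.\<close>

lemma density_L2_decay:
  assumes y: "y \<in> V" "\<zeta> \<in> Env" and T: "0 \<le> T" and s: "0 \<le> s"
    and M: "0 < M" "card E * (exp (- \<mu> * T) / (p * (1 - p))) \<le> ln M"
  defines "u \<equiv> (\<lambda>t. av (\<lambda>z. (density (y, \<zeta>) t z)\<^sup>2))"
  shows "ln (u (T + s)) \<le> 2 * ln M + d * ln 2 * exp (- (\<mu> * p / (3 * d) * s))"
proof -
  let ?U = "density (y, \<zeta>)"
  \<comment> \<open>Twice the constant of \<open>dirichlet_comparison\<close>, as the derivative of
    a square brings a factor 2.\<close>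
  define k where "k = \<mu> * p / (3 * d)"
  \<comment> \<open>\<open>u t - 1\<close> is the variance of the density, whose mean is 1;
    positivity of \<open>u t\<close> allows its logarithm to be differentiated.\<close>
  have u1: "1 \<le> u t" for t
  proof -
    have "0 \<le> av (\<lambda>z. (?U t z - 1)\<^sup>2)" by (rule av_nonneg) simp
    also have "(\<lambda>z. (?U t z - 1)\<^sup>2) = (\<lambda>z. ((?U t z)\<^sup>2 - 2 * ?U t z) + 1)"
      by (simp add: power2_eq_square algebra_simps fun_eq_iff)
    also have "av (\<lambda>z. ((?U t z)\<^sup>2 - 2 * ?U t z) + 1) = u t - 1"
      by (simp only: av_add av_diff av_cmult av_const av_density[OF y]) (simp add: u_def)
    finally show ?thesis by simp
  qed
  have marginal: "(\<Sum>x\<in>V. ?U t (x, \<eta>)) \<le> 2 ^ d * M" if t: "T \<le> t" and \<eta>: "\<eta> \<in> Env" for t \<eta>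
  proof (rule density_marginal_le[OF y _ \<eta> M(1)])
    have "exp (- \<mu> * t) / (p * (1 - p)) \<le> exp (- \<mu> * T) / (p * (1 - p))"
      using t \<mu> p by (intro divide_right_mono) auto
    then show "card E * (exp (- \<mu> * t) / (p * (1 - p))) \<le> ln M"
      using M(2) mult_left_mono by (smt (verit) of_nat_0_le_iff)
  qed (use t T in simp)
  have der: "(u has_real_derivative - 2 * dirichlet (?U t) (?U t)) (at t)" for t
  proof -
    have "(u has_real_derivative av (\<lambda>z. 2 * (?U t z * L (?U t) z))) (at t)"
      unfolding u_def
      by (rule av_has_derivative)
         (auto intro!: derivative_eq_intros kolmogorov_solutionD[OF kolmogorov_density] simp: mult_ac)
    then show ?thesis unfolding av_cmult av_generator by simp
  qed
  have decay: "- 2 * dirichlet (?U t) (?U t) / u t \<le> - k * (ln (u t) - 2 * ln M)" if t: "T \<le> t" for t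
  proof -
    have "u t * (ln (u t) - 2 * ln M) \<le> (\<Sum>i<d. av (\<lambda>z. (dir_diff i (?U t) z)\<^sup>2))"
      by (rule log_Sobolev_bounded_marginal)
         (use density_nonneg[OF y] marginal[OF t] M(1) u1[of t] t T in \<open>auto simp: u_def\<close>)
    then have "k / 2 * (u t * (ln (u t) - 2 * ln M))
        \<le> k / 2 * (\<Sum>i<d. av (\<lambda>z. (dir_diff i (?U t) z)\<^sup>2))"
      using \<mu> p by (intro mult_left_mono) (auto simp: k_def)
    also have "\<dots> \<le> dirichlet (?U t) (?U t)"
      using dirichlet_comparison[of "?U t"] by (simp add: k_def)
    finally have "- 2 * dirichlet (?U t) (?U t) \<le> - k * (ln (u t) - 2 * ln M) * u t"
      by (simp add: algebra_simps)
    then show ?thesis using u1[of t] by (subst pos_divide_le_eq) auto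
  qed
  \<comment> \<open>Integrating factor for the differential inequality.\<close>
  define w where "w = (\<lambda>t. exp (k * t) * (ln (u t) - 2 * ln M))"
  have "w (T + s) \<le> w T"
  proof (rule DERIV_nonpos_imp_nonincreasing[of T "T + s" w])
    fix t assume t: "T \<le> t" "t \<le> T + s"
    have "(w has_real_derivative exp (k * t) * k * (ln (u t) - 2 * ln M)
        + exp (k * t) * (- 2 * dirichlet (?U t) (?U t) / u t)) (at t)"
      unfolding w_def using u1[of t] by (auto intro!: derivative_eq_intros der)
    moreover have "exp (k * t) * k * (ln (u t) - 2 * ln M) + exp (k * t) * (- 2 * dirichlet (?U t) (?U t) / u t) \<le> 0"
      using mult_left_mono[OF decay[OF t(1)], of "exp (k * t)"] by (simp add: algebra_simps)
    ultimately show "\<exists>y. (w has_real_derivative y) (at t) \<and> y \<le> 0" by blast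
  qed (use s in simp)
  moreover have "w T \<le> exp (k * T) * (d * ln 2)"
  proof -
    \<comment> \<open>Crude bound for a walk possibly still concentrated at one vertex: a sum of
      squares of nonnegative numbers is at most the square of their sum.\<close>
    have "(\<Sum>x\<in>V. (?U T (x, \<eta>))\<^sup>2) \<le> (2 ^ d * M)\<^sup>2" if \<eta>: "\<eta> \<in> Env" for \<eta>
    proof -
      let ?S = "\<Sum>x\<in>V. ?U T (x, \<eta>)"
      have nn: "0 \<le> ?U T (x, \<eta>)" if "x \<in> V" for x
        by (rule density_nonneg[OF y T that \<eta>])
      have "(\<Sum>x\<in>V. (?U T (x, \<eta>))\<^sup>2) \<le> (\<Sum>x\<in>V. ?U T (x, \<eta>) * ?S)"
        unfolding power2_eq_square
        by (intro sum_mono mult_left_mono member_le_sum nn) auto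
      also have "\<dots> = ?S\<^sup>2" by (simp add: sum_distrib_right power2_eq_square)
      also have "\<dots> \<le> (2 ^ d * M)\<^sup>2"
        by (intro power_mono marginal \<eta> sum_nonneg nn) auto
      finally show ?thesis .
    qed
    then have "(\<Sum>\<eta>\<in>Env. wt \<eta> * (\<Sum>x\<in>V. (?U T (x, \<eta>))\<^sup>2)) \<le> (\<Sum>\<eta>\<in>Env. wt \<eta> * (2 ^ d * M)\<^sup>2)"
      by (intro sum_mono mult_left_mono less_imp_le[OF wt_pos])
    also have "\<dots> = (2 ^ d * M)\<^sup>2" by (simp add: sum_distrib_right[symmetric] sum_wt)
    finally have "(\<Sum>\<eta>\<in>Env. wt \<eta> * (\<Sum>x\<in>V. (?U T (x, \<eta>))\<^sup>2)) / 2 ^ d \<le> 2 ^ d * M\<^sup>2"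
      by (simp add: divide_le_eq power2_eq_square mult_ac)
    moreover have "u T = (\<Sum>\<eta>\<in>Env. wt \<eta> * (\<Sum>x\<in>V. (?U T (x, \<eta>))\<^sup>2)) / 2 ^ d"
      unfolding u_def av_def by (subst sum.swap) (simp add: sum_distrib_left)
    ultimately have "u T \<le> 2 ^ d * M\<^sup>2" by (simp only:)
    then have "ln (u T) \<le> ln (2 ^ d * M\<^sup>2)"
      using u1[of T] M(1) by (subst ln_le_cancel_iff) auto
    also have "\<dots> = d * ln 2 + 2 * ln M"
      using M(1) by (simp add: ln_mult ln_realpow)
    finally show ?thesis
      unfolding w_def by (intro mult_left_mono) auto
  qed
  ultimately have "exp (k * s) * (ln (u (T + s)) - 2 * ln M) \<le> d * ln 2"
    by (simp add: w_def distrib_left exp_add mult.assoc)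
  then have "exp (- (k * s)) * (exp (k * s) * (ln (u (T + s)) - 2 * ln M)) \<le> exp (- (k * s)) * (d * ln 2)"
    by (intro mult_left_mono) auto
  moreover have "exp (- (k * s)) * (exp (k * s) * r) = r" for r
    by (simp add: exp_minus field_simps)
  ultimately have "ln (u (T + s)) - 2 * ln M \<le> exp (- (k * s)) * (d * ln 2)" by simp
  then show ?thesis
    unfolding k_def[symmetric] by (simp only: diff_le_eq add.commute mult.commute)
qed

text \<open>At time \<open>2 * t\<close> the density is the inner product of two densities of mean
  1. Second moments at most \<open>5 / 4\<close> bound it above by the inequality of arithmetic and
  geometric means, and below by nonnegativity of the mean of
  \<open>(?f v + ?g v - 2)\<^sup>2\<close>.\<close>

lemma uniform_mixing_bound:
  assumes z: "z \<in> full_states V E" and w: "w \<in> full_states V E"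
    and L2: "\<And>y \<zeta>. y \<in> V \<Longrightarrow> \<zeta> \<in> Env \<Longrightarrow> av (\<lambda>v. (density (y, \<zeta>) t v)\<^sup>2) \<le> 5 / 4"
  shows "\<bar>full_prob V E \<mu> p (2 * t) z w / pi_full V E p w - 1\<bar> \<le> 1 / 4"
proof -
  obtain y \<zeta> y' \<zeta>' where zw: "z = (y, \<zeta>)" "w = (y', \<zeta>')" by fastforce
  have y: "y \<in> V" "\<zeta> \<in> Env" and y': "y' \<in> V" "\<zeta>' \<in> Env"
    using z w zw by (auto simp: states_iff)
  let ?f = "density (y, \<zeta>) t" and ?g = "density (y', \<zeta>') t"
  have eq: "full_prob V E \<mu> p (2 * t) z w / pi_full V E p w = av (\<lambda>v. ?f v * ?g v)"
    using density_split[OF y y', of t] by (simp add: zw full_prob_def density_def)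
  have "2 * av (\<lambda>v. ?f v * ?g v) \<le> av (\<lambda>v. (?f v)\<^sup>2) + av (\<lambda>v. (?g v)\<^sup>2)"
    unfolding av_cmult[symmetric] av_add[symmetric]
    by (rule av_mono) (use sum_squares_bound in \<open>simp add: mult.assoc\<close>)
  moreover have "4 \<le> 2 * av (\<lambda>v. ?f v * ?g v) + av (\<lambda>v. (?f v)\<^sup>2) + av (\<lambda>v. (?g v)\<^sup>2)"
  proof -
    have "0 \<le> av (\<lambda>v. (?f v + ?g v - 2)\<^sup>2)" by (rule av_nonneg) simp
    also have "(\<lambda>v. (?f v + ?g v - 2)\<^sup>2)
        = (\<lambda>v. ((?f v)\<^sup>2 + (?g v)\<^sup>2 + 2 * (?f v * ?g v) - 4 * ?f v - 4 * ?g v) + 4)"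
      by (simp add: power2_eq_square algebra_simps fun_eq_iff)
    also have "av \<dots> = av (\<lambda>v. (?f v)\<^sup>2) + av (\<lambda>v. (?g v)\<^sup>2) + 2 * av (\<lambda>v. ?f v * ?g v) - 4"
      by (simp only: av_add av_diff av_cmult av_const av_density[OF y] av_density[OF y'])
    finally show ?thesis by simp
  qed
  ultimately show ?thesis
    unfolding eq abs_le_iff using L2[OF y] L2[OF y'] by simp
qed

theorem full_tmix_inf_le:
  "full_tmix_inf V E \<mu> p \<le> ereal (2 * ((ln (16 * (d * 2 ^ d)) - ln p - ln (1 - p)) / \<mu>
      + 3 * d / (\<mu> * p) * ln (16 * d)))"
proof -
  \<comment> \<open>Chosen so that \<open>card E * (exp (- \<mu> * T) / (p * (1 - p)))\<close>
    equals \<open>1 / 32\<close>, below \<open>ln M = 1 / 16\<close>.\<close>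
  define T where "T = (ln (16 * (d * 2 ^ d)) - ln p - ln (1 - p)) / \<mu>"
  \<comment> \<open>Chosen so that the decay factor is \<open>1 / (16 * d)\<close>, turning the
    initial excess \<open>d * ln 2\<close> into \<open>ln 2 / 16\<close>.\<close>
  define s where "s = 3 * d / (\<mu> * p) * ln (16 * d)"
  have d1: "1 \<le> real d" using d by simp
  have "1 \<le> real d * 2 ^ d" using mult_mono[OF d1 one_le_power[of "2::real" d]] by simp
  then have d2: "1 \<le> 16 * (real d * 2 ^ d)" by simp
  have T: "0 \<le> T"
  proof -
    have "ln p < 0" "ln (1 - p) < 0" using p by auto
    then have "0 \<le> ln (16 * (d * 2 ^ d)) - ln p - ln (1 - p)"
      using ln_ge_zero[OF d2] by simp
    then show ?thesis unfolding T_def using \<mu> by simp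
  qed
  have s: "0 \<le> s" unfolding s_def using \<mu> p d1 by (intro mult_nonneg_nonneg) auto
  have "exp (- \<mu> * T) = p * (1 - p) / (16 * (d * 2 ^ d))"
  proof -
    have "- \<mu> * T = ln (p * (1 - p) / (16 * (d * 2 ^ d)))"
      using \<mu> p d by (simp add: T_def ln_div ln_mult)
    then show ?thesis using p d by simp
  qed
  then have "card E * (exp (- \<mu> * T) / (p * (1 - p))) = (2 * real (card E)) / (32 * (d * 2 ^ d))"
    using p by simp
  also have "2 * real (card E) = d * 2 ^ d"
    using arg_cong[OF card_hypercube_edges[of d], of real] by simp
  finally have M: "card E * (exp (- \<mu> * T) / (p * (1 - p))) \<le> ln (exp (1 / 16))"
    using d by simp
  have "\<mu> * p / (3 * d) * s = ln (16 * d)"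
    using \<mu> p d by (simp add: s_def)
  then have rate: "d * ln 2 * exp (- (\<mu> * p / (3 * d) * s)) = ln 2 / 16"
    using d by (simp add: exp_minus)
  have ln_le: "ln (av (\<lambda>v. (density (y, \<zeta>) (T + s) v)\<^sup>2)) \<le> 3 / 16"
    if "y \<in> V" "\<zeta> \<in> Env" for y \<zeta>
    using density_L2_decay[OF that T s exp_gt_zero M] ln2_le_25_over_36 unfolding rate ln_exp by linarith
  \<comment> \<open>From \<open>exp (- x) \<ge> 1 - x\<close> the bound is
    \<open>16 / 13\<close>.\<close>
  have exp_le: "exp (3 / 16) \<le> (5 / 4 :: real)"
  proof -
    have "13 / 16 \<le> exp (- (3 / 16) :: real)" using exp_ge_add_one_self[of "- (3 / 16) :: real"] by simp
    then show ?thesis by (simp add: exp_minus field_simps)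
  qed
  have L2: "av (\<lambda>v. (density (y, \<zeta>) (T + s) v)\<^sup>2) \<le> 5 / 4" if "y \<in> V" "\<zeta> \<in> Env" for y \<zeta>
  proof (cases "0 < av (\<lambda>v. (density (y, \<zeta>) (T + s) v)\<^sup>2)")
    case True
    then show ?thesis
      using iffD2[OF exp_le_cancel_iff ln_le[OF that]] exp_le by (simp only: exp_ln)
  qed simp
  have "2 * (T + s) \<in> {t. 0 \<le> t \<and> (\<forall>z\<in>full_states V E. \<forall>w\<in>full_states V E.
         \<bar>full_prob V E \<mu> p t z w / pi_full V E p w - 1\<bar> \<le> 1 / 4)}"
    by (intro CollectI conjI ballI uniform_mixing_bound L2) (use T s in simp_all)
  then have "full_tmix_inf V E \<mu> p \<le> ereal (2 * (T + s))"
    unfolding full_tmix_inf_def by (intro INF_lower)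
  then show ?thesis by (simp add: T_def s_def)
qed

end

section \<open>Absorbing all terms into one universal constant\<close>

theorem theorem1p9:
  shows "\<exists>C::real. C > 0 \<and>
    (\<forall>(d::nat) (\<mu>::real) (p::real). d \<ge> 2 \<longrightarrow> 0 < \<mu> \<longrightarrow> \<mu> \<le> 1 \<longrightarrow> 0 < p \<longrightarrow> p \<le> 1 \<longrightarrow>
      full_tmix_inf (hypercube_verts d) (hypercube_edges d) \<mu> p
        \<le> ereal C * (ereal (1 / (\<mu> * p) * real d * ln (real d)) + ereal (1 / \<mu>) * abs_log (1 - p)))"
proof (intro exI[of _ "40 :: real"] conjI allI impI)
  fix d :: nat and \<mu> p :: real
  assume dge: "2 \<le> d" and \<mu>: "0 < \<mu>" "\<mu> \<le> 1" and p: "0 < p" "p \<le> 1"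
  show "full_tmix_inf (hypercube_verts d) (hypercube_edges d) \<mu> p
        \<le> ereal 40 * (ereal (1 / (\<mu> * p) * real d * ln (real d)) + ereal (1 / \<mu>) * abs_log (1 - p))"
  proof (cases "p = 1")
    case True
    then show ?thesis using \<mu> by (simp add: abs_log_def)
  next
    case False
    then have p1: "p < 1" using p by simp
    interpret percolation_cube d \<mu> p by unfold_locales (use dge \<mu> p p1 in auto)
    define D where "D = d * ln d"
    have ln2: "1 / 2 \<le> ln (2::real)" using ln2_ge_two_thirds by simp
    have lnd: "ln 2 \<le> ln (real d)" using dge by simp
    have D1: "2 * ln 2 \<le> D" unfolding D_def using dge lnd ln2 by (intro mult_mono) auto
    have Dd: "d * ln 2 \<le> D" unfolding D_def using lnd by (intro mult_left_mono) auto
    have D2: "ln d \<le> D" unfolding D_def using dge lnd ln2 mult_right_mono[of 1 "real d" "ln d"] by simp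
    have Dp: "D \<le> D / p"
      using p D1 ln2 by (simp add: le_divide_eq mult_left_le)
    \<comment> \<open>The logarithm of \<open>1 / p\<close> is dominated by \<open>1 / p\<close>
      itself, and \<open>D \<ge> 1\<close> because \<open>2 * ln 2 \<ge> 1\<close>.\<close>
    have lp: "- ln p \<le> D / p"
    proof -
      have "- ln p = ln (1 / p)" using p by (simp add: ln_div)
      also have "\<dots> \<le> 1 / p - 1" using p by (intro ln_le_minus_one) auto
      also have "\<dots> \<le> D / p" using p D1 ln2 divide_right_mono[of 1 D p] by simp
      finally show ?thesis .
    qed
    have l16: "ln 16 = 4 * ln (2::real)"
      using ln_realpow[of "2::real" 4] by simp
    have e1: "ln (16 * (d * 2 ^ d)) = 4 * ln 2 + ln d + d * ln 2" "ln (16 * d) = 4 * ln 2 + ln d"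
      using d l16 by (simp_all add: ln_mult ln_realpow)
    have "2 * ((ln (16 * (d * 2 ^ d)) - ln p - ln (1 - p)) / \<mu> + 3 * d / (\<mu> * p) * ln (16 * d))
        = (2 * (ln (16 * (d * 2 ^ d)) - ln p - ln (1 - p)) + 6 * (d * ln (16 * d)) / p) / \<mu>"
      using \<mu> p by (simp add: field_simps)
    \<comment> \<open>In units of \<open>D / p\<close>, the terms \<open>8 * ln 2\<close>,
      \<open>2 * ln d\<close>, \<open>2 * d * ln 2\<close> and \<open>- 2 * ln p\<close> cost at
      most 4, 2, 2 and 2, and the decay time costs 30.\<close>
    also have "\<dots> \<le> (40 * (D / p) + 40 * \<bar>ln (1 - p)\<bar>) / \<mu>"
    proof (rule divide_right_mono)
      have "d * ln (16 * d) = 4 * (d * ln 2) + D"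
        unfolding e1 D_def by (simp add: algebra_simps)
      then have "d * ln (16 * d) \<le> 5 * D" using Dd by linarith
      from divide_right_mono[OF this less_imp_le[OF p(1)]]
      have "6 * (d * ln (16 * d)) / p \<le> 30 * (D / p)" by simp
      then show "2 * (ln (16 * (d * 2 ^ d)) - ln p - ln (1 - p)) + 6 * (d * ln (16 * d)) / p
          \<le> 40 * (D / p) + 40 * \<bar>ln (1 - p)\<bar>"
        using D1 D2 Dd Dp lp abs_ge_minus_self[of "ln (1 - p)"] abs_ge_zero[of "ln (1 - p)"]
        unfolding e1(1) distrib_left right_diff_distrib by linarith
    qed (use \<mu> in simp)
    also have "\<dots> = 40 * (1 / (\<mu> * p) * real d * ln (real d) + 1 / \<mu> * \<bar>ln (1 - p)\<bar>)"
      using \<mu> p by (simp add: D_def field_simps)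
    finally have "full_tmix_inf V E \<mu> p \<le> ereal (40 * (1 / (\<mu> * p) * real d * ln (real d) + 1 / \<mu> * \<bar>ln (1 - p)\<bar>))"
      by (intro order_trans[OF full_tmix_inf_le]) (simp only: ereal_less_eq)
    then show ?thesis using p1 by (simp add: abs_log_def)
  qed
qed simp

end
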